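(* Let $p\in F_I^\circ$ and assume $M_I<2$. If $\{q_n\}$ and $\{q_n'\}$ are two sequences in $X^\circ$ with $q_n\to p$ and $q_n'\to p$ in the background topology, then $$d_{g_\Sigma}(q_n,q_n')\longrightarrow 0 .$$ Consequently, all sequences in $X^\circ$ converging to $p$ in the background topology determine the same point of the metric completion of $(X^\circ,d_{g_\Sigma})$.
   Context: Let $X$ be a compact smooth $n$-dimensional manifold with corners (locally modelled on $[0,\infty)^k\times\mathbb R^{n-k}$, $0\le k\le n$) whose boundary hypersurfaces $H_1,\dots,H_N$ are globally embedded, and let $X^\circ=X\setminus\partial X$. For each $i$ let $\rho_i:X\to[0,\infty)$ be a smooth boundary-defining function of $H_i$: $H_i=\rho_i^{-1}(0)$, $d\rho_i\neq0$ on $H_i$, and $\rho_i>0$ on $X\setminus H_i$. Let $g_0$ be a smooth Riemannian metric on $X$ (up to the boundary), and let $\alpha_1,\dots,\alpha_N\ge 0$. The sum metric on $X^\circ$ is $g_\Sigma=\bigl(\sum_{i=1}^N\rho_i^{-\alpha_i}\bigr)g_0$, and $d_{g_\Sigma}$ is its Riemannian distance on $X^\circ$. The background topology is the topology of $X$. For $p\in X$, $I(p)=\{i: p\in H_i\}$ is the active index set; for nonempty $I\subseteq\{1,\dots,N\}$, $F_I^\circ=\{p\in X: I(p)=I\}$ is the corresponding open face; and $M_I=\max_{i\in I}\alpha_i$. A sequence determines a point of the metric completion when it is Cauchy; that point is its equivalence class. *)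

theory Defs
  imports "HOL-Analysis.Analysis"
begin

subsection \<open>Smooth maps on subsets of Euclidean space\<close>

primrec Ck_on_open :: "nat \<Rightarrow> 'a::euclidean_space set \<Rightarrow> ('a \<Rightarrow> 'b::real_normed_vector) \<Rightarrow> bool" where
  "Ck_on_open 0 U f \<longleftrightarrow> continuous_on U f"
| "Ck_on_open (Suc k) U f \<longleftrightarrow>
     (\<forall>x\<in>U. f differentiable (at x)) \<and>
     (\<forall>v. Ck_on_open k U (\<lambda>x. frechet_derivative f (at x) v))"

text \<open>On a set that need not be open, such as a relatively open piece of a quadrant, a map is
  smooth if near each point it is the restriction of a smooth map defined on an open set.\<close>

definition smooth_on :: "'a::euclidean_space set \<Rightarrow> ('a \<Rightarrow> 'b::real_normed_vector) \<Rightarrow> bool" where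
  "smooth_on S f \<longleftrightarrow>
     (\<forall>x\<in>S. \<exists>U F. open U \<and> x \<in> U \<and> (\<forall>k. Ck_on_open k U F) \<and> (\<forall>y\<in>U \<inter> S. F y = f y))"

subsection \<open>Manifolds with corners\<close>

text \<open>The model space \<open>[0,\<infinity>)\<^sup>k \<times> \<real>\<^sup>n\<^sup>-\<^sup>k\<close>, where \<open>k\<close> is the cardinality of \<open>K\<close> and the half-line
  coordinates are those with index in \<open>K\<close>.\<close>

definition quadrant :: "'n set \<Rightarrow> (real^'n::finite) set" where
  "quadrant K = {x. \<forall>i\<in>K. 0 \<le> x $ i}"

record ('a, 'n::finite) corner_chart =
  chart_dom :: "'a set"
  chart_map :: "'a \<Rightarrow> real^'n"
  chart_walls :: "'n set"  \<comment> \<open>the index set \<open>K\<close> of the model quadrant\<close>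

definition is_corner_chart :: "'a topology \<Rightarrow> ('a, 'n::finite) corner_chart \<Rightarrow> bool" where
  "is_corner_chart X c \<longleftrightarrow>
     openin X (chart_dom c) \<and>
     openin (top_of_set (quadrant (chart_walls c))) (chart_map c ` chart_dom c) \<and>
     homeomorphic_map (subtopology X (chart_dom c)) (top_of_set (chart_map c ` chart_dom c))
       (chart_map c)"

definition chart_inv :: "('a, 'n::finite) corner_chart \<Rightarrow> real^'n \<Rightarrow> 'a" where
  "chart_inv c = inv_into (chart_dom c) (chart_map c)"

definition chart_transition ::
    "('a, 'n::finite) corner_chart \<Rightarrow> ('a, 'n) corner_chart \<Rightarrow> real^'n \<Rightarrow> real^'n" where
  "chart_transition c c' = chart_map c' \<circ> chart_inv c"

text \<open>\<open>\<A>\<close> is a smooth atlas, not required to be maximal. Second countability is not listed: it is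
  automatic for compact \<open>X\<close>.\<close>

definition manifold_with_corners :: "'a topology \<Rightarrow> ('a, 'n::finite) corner_chart set \<Rightarrow> bool" where
  "manifold_with_corners X \<A> \<longleftrightarrow>
     Hausdorff_space X \<and>
     (\<forall>c\<in>\<A>. is_corner_chart X c) \<and>
     (\<Union>c\<in>\<A>. chart_dom c) = topspace X \<and>
     (\<forall>c\<in>\<A>. \<forall>c'\<in>\<A>.
        smooth_on (chart_map c ` (chart_dom c \<inter> chart_dom c')) (chart_transition c c'))"

definition active_walls :: "('a, 'n::finite) corner_chart \<Rightarrow> 'a \<Rightarrow> 'n set" where
  "active_walls c p = {i \<in> chart_walls c. chart_map c p $ i = 0}"

definition mfd_boundary :: "('a, 'n::finite) corner_chart set \<Rightarrow> 'a set" where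
  "mfd_boundary \<A> = {p. \<exists>c\<in>\<A>. p \<in> chart_dom c \<and> active_walls c p \<noteq> {}}"

definition mfd_interior :: "'a topology \<Rightarrow> ('a, 'n::finite) corner_chart set \<Rightarrow> 'a set" where
  "mfd_interior X \<A> = topspace X - mfd_boundary \<A>"

definition codim1_points :: "('a, 'n::finite) corner_chart set \<Rightarrow> 'a set" where
  "codim1_points \<A> = {p. \<exists>c\<in>\<A>. p \<in> chart_dom c \<and> card (active_walls c p) = 1}"

text \<open>As usual, a boundary hypersurface is the closure of a connected component of the set of
  boundary points of codimension one.\<close>

definition boundary_hypersurfaces ::
    "'a topology \<Rightarrow> ('a, 'n::finite) corner_chart set \<Rightarrow> 'a set set" where
  "boundary_hypersurfaces X \<A> =
     (\<lambda>C. X closure_of C) ` connected_components_of (subtopology X (codim1_points \<A>))"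

text \<open>Embeddedness excludes self-intersections: near each of its points (corners included), the
  hypersurface is a single coordinate wall.\<close>

definition embedded_hypersurface ::
    "'a topology \<Rightarrow> ('a, 'n::finite) corner_chart set \<Rightarrow> 'a set \<Rightarrow> bool" where
  "embedded_hypersurface X \<A> H \<longleftrightarrow>
     (\<forall>p\<in>H. \<exists>c\<in>\<A>. \<exists>j\<in>chart_walls c. \<exists>V. openin X V \<and> p \<in> V \<and> V \<subseteq> chart_dom c \<and>
        H \<inter> V = {q\<in>V. chart_map c q $ j = 0})"

definition smooth_function :: "('a, 'n::finite) corner_chart set \<Rightarrow> ('a \<Rightarrow> real) \<Rightarrow> bool" where
  "smooth_function \<A> f \<longleftrightarrow>
     (\<forall>c\<in>\<A>. smooth_on (chart_map c ` chart_dom c) (f \<circ> chart_inv c))"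

text \<open>Derivatives at boundary points are taken within the image of the chart. They are unique there,
  since relatively open subsets of a quadrant have tangent directions spanning the whole space.\<close>

definition nonzero_differential_at ::
    "('a, 'n::finite) corner_chart set \<Rightarrow> ('a \<Rightarrow> real) \<Rightarrow> 'a \<Rightarrow> bool" where
  "nonzero_differential_at \<A> f p \<longleftrightarrow>
     (\<forall>c\<in>\<A>. p \<in> chart_dom c \<longrightarrow>
        (\<exists>D. ((f \<circ> chart_inv c) has_derivative D)
               (at (chart_map c p) within chart_map c ` chart_dom c) \<and> D \<noteq> (\<lambda>v. 0)))"

definition boundary_defining_function ::
    "'a topology \<Rightarrow> ('a, 'n::finite) corner_chart set \<Rightarrow> 'a set \<Rightarrow> ('a \<Rightarrow> real) \<Rightarrow> bool" where
  "boundary_defining_function X \<A> H \<rho> \<longleftrightarrow>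
     smooth_function \<A> \<rho> \<and>
     (\<forall>p\<in>topspace X. 0 \<le> \<rho> p) \<and>
     H = {p\<in>topspace X. \<rho> p = 0} \<and>
     (\<forall>p\<in>H. nonzero_differential_at \<A> \<rho> p) \<and>
     (\<forall>p\<in>topspace X - H. 0 < \<rho> p)"

subsection \<open>Riemannian metrics and distance\<close>

text \<open>A metric tensor is given by its local representatives: \<open>g c p u v\<close> is the inner product of the
  tangent vectors at \<open>p\<close> with components \<open>u\<close> and \<open>v\<close> in the chart \<open>c\<close>. The last condition of
  \<open>riemannian_metric\<close> is the tensor transformation law.\<close>

type_synonym ('a, 'n) metric_tensor =
  "('a, 'n) corner_chart \<Rightarrow> 'a \<Rightarrow> real^'n \<Rightarrow> real^'n \<Rightarrow> real"

definition riemannian_metric ::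
    "('a, 'n::finite) corner_chart set \<Rightarrow> ('a, 'n) metric_tensor \<Rightarrow> bool" where
  "riemannian_metric \<A> g \<longleftrightarrow>
     (\<forall>c\<in>\<A>. \<forall>p\<in>chart_dom c.
        bilinear (g c p) \<and> (\<forall>u v. g c p u v = g c p v u) \<and> (\<forall>u. u \<noteq> 0 \<longrightarrow> 0 < g c p u u)) \<and>
     (\<forall>c\<in>\<A>. \<forall>u v. smooth_on (chart_map c ` chart_dom c) (\<lambda>x. g c (chart_inv c x) u v)) \<and>
     (\<forall>c\<in>\<A>. \<forall>c'\<in>\<A>. \<forall>p\<in>chart_dom c \<inter> chart_dom c'. \<forall>D.
        (chart_transition c c' has_derivative D)
          (at (chart_map c p) within chart_map c ` (chart_dom c \<inter> chart_dom c')) \<longrightarrow>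
        (\<forall>u v. g c p u v = g c' p (D u) (D v)))"

definition C1_on_interval :: "real \<Rightarrow> real \<Rightarrow> (real \<Rightarrow> 'b::real_normed_vector) \<Rightarrow> bool" where
  "C1_on_interval s t f \<longleftrightarrow>
     (\<exists>D. continuous_on {s..t} D \<and>
          (\<forall>r\<in>{s..t}. (f has_vector_derivative D r) (at r within {s..t})))"

text \<open>A piecewise \<open>C\<^sup>1\<close> curve in \<open>M \<subseteq> X\<close>. Here \<open>P\<close> is the set of break points; away from them the
  curve is \<open>C\<^sup>1\<close>, with one-sided derivatives up to and including the break points.\<close>

definition piecewise_C1_curve ::
    "'a topology \<Rightarrow> ('a, 'n::finite) corner_chart set \<Rightarrow> 'a set \<Rightarrow> real \<Rightarrow> real \<Rightarrow> (real \<Rightarrow> 'a) \<Rightarrow> bool" where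
  "piecewise_C1_curve X \<A> M a b \<gamma> \<longleftrightarrow>
     continuous_map (top_of_set {a..b}) (subtopology X M) \<gamma> \<and>
     (\<exists>P. finite P \<and>
        (\<forall>s t. a \<le> s \<and> s \<le> t \<and> t \<le> b \<and> {s<..<t} \<inter> P = {} \<longrightarrow>
           (\<forall>c\<in>\<A>. \<gamma> ` {s..t} \<subseteq> chart_dom c \<longrightarrow> C1_on_interval s t (chart_map c \<circ> \<gamma>))))"

text \<open>The chart used to compute the speed is immaterial by the transformation law. At break points
  and end points the value is meaningless, but there are finitely many of them.\<close>

definition curve_speed ::
    "('a, 'n::finite) corner_chart set \<Rightarrow> ('a, 'n) metric_tensor \<Rightarrow> (real \<Rightarrow> 'a) \<Rightarrow> real \<Rightarrow> real" where
  "curve_speed \<A> g \<gamma> t =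
     (let c = (SOME c. c \<in> \<A> \<and> \<gamma> t \<in> chart_dom c);
          w = vector_derivative (chart_map c \<circ> \<gamma>) (at t)
      in sqrt (g c (\<gamma> t) w w))"

definition curve_length ::
    "('a, 'n::finite) corner_chart set \<Rightarrow> ('a, 'n) metric_tensor \<Rightarrow> real \<Rightarrow> real \<Rightarrow> (real \<Rightarrow> 'a) \<Rightarrow> ennreal" where
  "curve_length \<A> g a b \<gamma> = (\<integral>\<^sup>+t\<in>{a..b}. ennreal (curve_speed \<A> g \<gamma> t) \<partial>lborel)"

text \<open>The distance is \<open>\<infinity>\<close> between points of different connected components of \<open>M\<close>.\<close>

definition riemannian_distance ::
    "'a topology \<Rightarrow> ('a, 'n::finite) corner_chart set \<Rightarrow> 'a set \<Rightarrow> ('a, 'n) metric_tensor \<Rightarrow> 'a \<Rightarrow> 'a \<Rightarrow> ennreal" where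
  "riemannian_distance X \<A> M g x y =
     Inf {curve_length \<A> g a b \<gamma> | a b \<gamma>.
            a \<le> b \<and> piecewise_C1_curve X \<A> M a b \<gamma> \<and> \<gamma> a = x \<and> \<gamma> b = y}"

subsection \<open>The sum metric and the open faces\<close>

definition sum_metric ::
    "nat \<Rightarrow> (nat \<Rightarrow> 'a \<Rightarrow> real) \<Rightarrow> (nat \<Rightarrow> real) \<Rightarrow> ('a, 'n::finite) metric_tensor \<Rightarrow> ('a, 'n) metric_tensor" where
  "sum_metric N \<rho> \<alpha> g0 c p u v = (\<Sum>i=1..N. \<rho> i p powr (- \<alpha> i)) * g0 c p u v"

definition active_index_set :: "nat \<Rightarrow> (nat \<Rightarrow> 'a set) \<Rightarrow> 'a \<Rightarrow> nat set" where
  "active_index_set N H p = {i\<in>{1..N}. p \<in> H i}"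

definition open_face :: "'a topology \<Rightarrow> nat \<Rightarrow> (nat \<Rightarrow> 'a set) \<Rightarrow> nat set \<Rightarrow> 'a set" where
  "open_face X N H I = {p\<in>topspace X. active_index_set N H p = I}"

subsection \<open>Metric completion of a set with an extended distance\<close>

definition cauchy_seqs :: "'a set \<Rightarrow> ('a \<Rightarrow> 'a \<Rightarrow> ennreal) \<Rightarrow> (nat \<Rightarrow> 'a) set" where
  "cauchy_seqs M d =
     {q. range q \<subseteq> M \<and> (\<forall>\<epsilon>>0. \<exists>k. \<forall>m\<ge>k. \<forall>n\<ge>k. d (q m) (q n) < \<epsilon>)}"

definition cauchy_equiv :: "'a set \<Rightarrow> ('a \<Rightarrow> 'a \<Rightarrow> ennreal) \<Rightarrow> ((nat \<Rightarrow> 'a) \<times> (nat \<Rightarrow> 'a)) set" where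
  "cauchy_equiv M d =
     {(q, q'). q \<in> cauchy_seqs M d \<and> q' \<in> cauchy_seqs M d \<and> (\<lambda>n. d (q n) (q' n)) \<longlonglongrightarrow> 0}"

definition metric_completion :: "'a set \<Rightarrow> ('a \<Rightarrow> 'a \<Rightarrow> ennreal) \<Rightarrow> (nat \<Rightarrow> 'a) set set" where
  "metric_completion M d = cauchy_seqs M d // cauchy_equiv M d"

definition determines_point ::
    "'a set \<Rightarrow> ('a \<Rightarrow> 'a \<Rightarrow> ennreal) \<Rightarrow> (nat \<Rightarrow> 'a) \<Rightarrow> (nat \<Rightarrow> 'a) set \<Rightarrow> bool" where
  "determines_point M d q \<xi> \<longleftrightarrow> q \<in> cauchy_seqs M d \<and> \<xi> = cauchy_equiv M d `` {q}"

end

theory Submission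
  imports Defs
begin

text \<open>Near \<open>p\<close> work in one chart, with wall coordinates \<open>x\<^sub>j \<ge> 0\<close>. A boundary defining function
  \<open>\<rho>\<^sub>i\<close> vanishing at \<open>p\<close> is bounded below by a multiple of a single wall coordinate, and the others
  are bounded away from \<open>0\<close>. So where all wall coordinates are at least \<open>h \<le> 1\<close>, the sum metric is at
  most \<open>C h\<^sup>-\<^sup>M\<close> times the Euclidean one, with \<open>M = M\<^sub>I\<close>. If \<open>x\<close> and \<open>y\<close> are interior points with
  \<open>|x - y| \<le> s\<close>, the curve \<open>x + t (y - x) + s t (1 - t) (1, \<dots>, 1)\<close> has wall coordinates at least
  \<open>s t (1 - t)\<close> and Euclidean speed \<open>O(s)\<close>, so its length is at most a multiple of \<open>s\<^bsup>1 - M/2\<^esup>\<close> times a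
  Beta integral that converges for \<open>M < 2\<close>. Hence small neighbourhoods of \<open>p\<close> have small diameter.\<close>

subsection \<open>Concatenation of curves\<close>

text \<open>Two interior points near \<open>p\<close> may be far closer to the walls than to each
  other, so along the straight segment between them the conformal factor admits no uniform bound.
  The lift has a height that depends only on \<open>s\<close> and \<open>t\<close>, not on the
  distance of the end points to the walls; this makes the estimate uniform over all pairs of points
  in a neighbourhood. The maximum of the active weights is the right exponent because the weights
  are added rather than multiplied: if every wall coordinate is at least \<open>h\<close>, each
  summand is separately of order at most \<open>h powr (- M)\<close>, however many walls meet at
  \<open>p\<close>. One explicit curve in one chart serves each pair of points, so convergence of
  distances and the Cauchy property come from the same neighbourhood. Concatenation of curves serves
  the triangle inequality, which is what identifies the classes of two Cauchy sequences.\<close>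

text \<open>The speed of a curve depends on an arbitrary choice of charts and need not be measurable a priori, so
  additivity and translation of its integral go through the measurable minorants.\<close>

lemma nn_integral_leI_measurable:
  assumes "\<And>g. g \<in> borel_measurable M \<Longrightarrow> (\<And>x. g x \<le> f x) \<Longrightarrow> (\<integral>\<^sup>+x. g x \<partial>M) \<le> C"
  shows "(\<integral>\<^sup>+x. f x \<partial>M) \<le> C"
  unfolding nn_integral_def
proof (rule SUP_least, clarify)
  fix g assume "simple_function M g" "g \<le> f"
  then show "integral\<^sup>S M g \<le> C"
    using assms[of g] by (simp add: borel_measurable_simple_function nn_integral_eq_simple_integral le_fun_def)
qed

lemma set_nn_integral_Un_le:
  assumes "A \<in> sets M" "B \<in> sets M"
  shows "(\<integral>\<^sup>+x\<in>A \<union> B. f x \<partial>M) \<le> (\<integral>\<^sup>+x\<in>A. f x \<partial>M) + (\<integral>\<^sup>+x\<in>B. f x \<partial>M)"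
proof (rule nn_integral_leI_measurable)
  fix g :: "'a \<Rightarrow> ennreal"
  assume g: "g \<in> borel_measurable M" and le: "\<And>x. g x \<le> f x * indicator (A \<union> B) x"
  \<comment> \<open>The minorant vanishes off \<open>A \<union> B\<close>, so its two truncations
    cover it; points of \<open>A \<inter> B\<close> are counted twice, whence an inequality.\<close>
  have "(\<integral>\<^sup>+x. g x \<partial>M) \<le> (\<integral>\<^sup>+x. g x * indicator A x + g x * indicator B x \<partial>M)"
  proof (intro nn_integral_mono)
    fix x
    show "g x \<le> g x * indicator A x + g x * indicator B x"
      using le[of x] by (auto simp: indicator_def split: if_splits)
  qed
  also have "\<dots> = (\<integral>\<^sup>+x. g x * indicator A x \<partial>M) + (\<integral>\<^sup>+x. g x * indicator B x \<partial>M)"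
    using g assms by (intro nn_integral_add borel_measurable_times_ennreal borel_measurable_indicator)
  also have "\<dots> \<le> (\<integral>\<^sup>+x\<in>A. f x \<partial>M) + (\<integral>\<^sup>+x\<in>B. f x \<partial>M)"
  proof (intro add_mono nn_integral_mono)
    fix x
    have "g x \<le> f x"
      using le[of x] by (cases "x \<in> A \<union> B") auto
    then show "g x * indicator A x \<le> f x * indicator A x"
      and "g x * indicator B x \<le> f x * indicator B x"
      by (auto intro: mult_right_mono)
  qed
  finally show "(\<integral>\<^sup>+x. g x \<partial>M) \<le> (\<integral>\<^sup>+x\<in>A. f x \<partial>M) + (\<integral>\<^sup>+x\<in>B. f x \<partial>M)" .
qed

lemma nn_integral_shift_le:
  fixes f :: "real \<Rightarrow> ennreal"
  shows "(\<integral>\<^sup>+t. f (c + t) \<partial>lborel) \<le> (\<integral>\<^sup>+t. f t \<partial>lborel)"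
proof (rule nn_integral_leI_measurable)
  fix g :: "real \<Rightarrow> ennreal"
  assume g: "g \<in> borel_measurable lborel" and le: "\<And>t. g t \<le> f (c + t)"
  have "(\<integral>\<^sup>+t. g t \<partial>lborel) = (\<integral>\<^sup>+t. g (- c + t) \<partial>lborel)"
    using nn_integral_real_affine[of g 1 "- c"] g by simp
  also have "\<dots> \<le> (\<integral>\<^sup>+t. f t \<partial>lborel)"
  proof (intro nn_integral_mono)
    fix t show "g (- c + t) \<le> f t" using le[of "- c + t"] by simp
  qed
  finally show "(\<integral>\<^sup>+t. g t \<partial>lborel) \<le> (\<integral>\<^sup>+t. f t \<partial>lborel)" .
qed

lemma C1_on_interval_cong:
  assumes "C1_on_interval s t f" "\<And>r. r \<in> {s..t} \<Longrightarrow> f r = g r"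
  shows "C1_on_interval s t g"
proof -
  obtain D where D: "continuous_on {s..t} D"
    "\<And>r. r \<in> {s..t} \<Longrightarrow> (f has_vector_derivative D r) (at r within {s..t})"
    using assms(1) by (auto simp: C1_on_interval_def)
  have "(g has_vector_derivative D r) (at r within {s..t})" if "r \<in> {s..t}" for r
    using has_vector_derivative_transform[OF that _ D(2)[OF that]] assms(2) by metis
  with D(1) show ?thesis by (auto simp: C1_on_interval_def)
qed

lemma C1_on_interval_shift:
  assumes "C1_on_interval (s + k) (t + k) f"
  shows "C1_on_interval s t (\<lambda>r. f (r + k))"
proof -
  obtain D where D: "continuous_on {s + k..t + k} D"
    "\<And>r. r \<in> {s + k..t + k} \<Longrightarrow> (f has_vector_derivative D r) (at r within {s + k..t + k})"
    using assms by (auto simp: C1_on_interval_def)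
  have img: "(\<lambda>r. r + k) ` {s..t} = {s + k..t + k}" by simp
  have "continuous_on {s..t} (\<lambda>r. D (r + k))"
    by (rule continuous_on_compose2[OF D(1)]) (auto intro: continuous_on_add)
  moreover have "((\<lambda>r. f (r + k)) has_vector_derivative D (r + k)) (at r within {s..t})"
    if "r \<in> {s..t}" for r
  proof -
    have "((f \<circ> (\<lambda>r. r + k)) has_vector_derivative (1 *\<^sub>R D (r + k))) (at r within {s..t})"
    proof (rule vector_diff_chain_within)
      show "((\<lambda>r. r + k) has_vector_derivative 1) (at r within {s..t})"
        by (auto intro!: derivative_eq_intros)
      show "(f has_vector_derivative D (r + k)) (at (r + k) within (\<lambda>r. r + k) ` {s..t})"
        unfolding img using D(2)[of "r + k"] that by auto
    qed
    then show ?thesis by (simp add: o_def)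
  qed
  ultimately show ?thesis by (auto simp: C1_on_interval_def)
qed

text \<open>Curves live on arbitrary intervals, so the second one is translated by \<open>k\<close>,
  of either sign, to start at time \<open>b\<close>; nothing has to be rescaled.\<close>

definition join_curves :: "real \<Rightarrow> real \<Rightarrow> (real \<Rightarrow> 'a) \<Rightarrow> (real \<Rightarrow> 'a) \<Rightarrow> real \<Rightarrow> 'a" where
  "join_curves b k \<gamma>1 \<gamma>2 t = (if t \<le> b then \<gamma>1 t else \<gamma>2 (t + k))"

lemma piecewise_C1_curve_join:
  assumes \<gamma>1: "piecewise_C1_curve X \<A> M a b \<gamma>1" and \<gamma>2: "piecewise_C1_curve X \<A> M (b + k) (e + k) \<gamma>2"
    and "a \<le> b" "b \<le> e" and meet: "\<gamma>1 b = \<gamma>2 (b + k)"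
  shows "piecewise_C1_curve X \<A> M a e (join_curves b k \<gamma>1 \<gamma>2)" (is "piecewise_C1_curve X \<A> M a e ?\<gamma>")
proof -
  let ?T = "top_of_set {a..e}"
  have left: "?\<gamma> r = \<gamma>1 r" if "r \<le> b" for r using that by (simp add: join_curves_def)
  have right: "?\<gamma> r = \<gamma>2 (r + k)" if "b \<le> r" for r
    using that meet by (auto simp: join_curves_def)
  have c1: "continuous_map (top_of_set {a..b}) (subtopology X M) \<gamma>1"
    and c2: "continuous_map (top_of_set {b + k..e + k}) (subtopology X M) \<gamma>2"
    using \<gamma>1 \<gamma>2 by (auto simp: piecewise_C1_curve_def)
  have cont: "continuous_map ?T (subtopology X M) ?\<gamma>"
    unfolding join_curves_def
  proof (rule continuous_map_cases_le)
    have "{a..e} \<inter> {x \<in> topspace ?T. x \<le> b} = {a..b}"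
      using \<open>b \<le> e\<close> by auto
    then have "subtopology ?T {x \<in> topspace ?T. x \<le> b} = top_of_set {a..b}"
      by (simp only: subtopology_subtopology)
    with c1 show "continuous_map (subtopology ?T {x \<in> topspace ?T. x \<le> b}) (subtopology X M) \<gamma>1"
      by simp
    have "{a..e} \<inter> {x \<in> topspace ?T. b \<le> x} = {b..e}"
      using \<open>a \<le> b\<close> by auto
    then have *: "subtopology ?T {x \<in> topspace ?T. b \<le> x} = top_of_set {b..e}"
      by (simp only: subtopology_subtopology)
    have "continuous_map (top_of_set {b..e}) (top_of_set {b + k..e + k}) (\<lambda>r. r + k)"
      by (auto intro: continuous_on_add)
    from continuous_map_compose[OF this c2]
    show "continuous_map (subtopology ?T {x \<in> topspace ?T. b \<le> x}) (subtopology X M) (\<lambda>r. \<gamma>2 (r + k))"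
      unfolding * by (simp add: o_def)
  qed (use meet in \<open>auto simp: continuous_map_in_subtopology\<close>)
  obtain P1 where P1: "finite P1" "\<And>s t c. a \<le> s \<Longrightarrow> s \<le> t \<Longrightarrow> t \<le> b \<Longrightarrow> {s<..<t} \<inter> P1 = {} \<Longrightarrow>
      c \<in> \<A> \<Longrightarrow> \<gamma>1 ` {s..t} \<subseteq> chart_dom c \<Longrightarrow> C1_on_interval s t (chart_map c \<circ> \<gamma>1)"
    using \<gamma>1 unfolding piecewise_C1_curve_def by metis
  obtain P2 where P2: "finite P2" "\<And>s t c. b + k \<le> s \<Longrightarrow> s \<le> t \<Longrightarrow> t \<le> e + k \<Longrightarrow> {s<..<t} \<inter> P2 = {} \<Longrightarrow>
      c \<in> \<A> \<Longrightarrow> \<gamma>2 ` {s..t} \<subseteq> chart_dom c \<Longrightarrow> C1_on_interval s t (chart_map c \<circ> \<gamma>2)"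
    using \<gamma>2 unfolding piecewise_C1_curve_def by metis
  \<comment> \<open>The junction must be a break point, since the one-sided derivatives may differ
    there. It also forces every admissible piece \<open>{s..t}\<close> onto one side of
    \<open>b\<close>.\<close>
  let ?P = "insert b (P1 \<union> (\<lambda>r. r - k) ` P2)"
  have "C1_on_interval s t (chart_map c \<circ> ?\<gamma>)"
    if "a \<le> s" "s \<le> t" "t \<le> e" and dis: "{s<..<t} \<inter> ?P = {}"
      and "c \<in> \<A>" and sub: "?\<gamma> ` {s..t} \<subseteq> chart_dom c" for s t c
  proof (cases "t \<le> b")
    case True
    have "?\<gamma> ` {s..t} = \<gamma>1 ` {s..t}" using True by (intro image_cong) (simp_all add: left)
    then have "C1_on_interval s t (chart_map c \<circ> \<gamma>1)"
      using that True dis by (intro P1(2)) blast+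
    then show ?thesis by (rule C1_on_interval_cong) (use True left in simp)
  next
    case False
    have "b \<notin> {s<..<t}" using dis by blast
    with False have "b \<le> s" by simp
    have "\<gamma>2 ` {s + k..t + k} = ?\<gamma> ` {s..t}"
    proof -
      have "{s + k..t + k} = (\<lambda>r. r + k) ` {s..t}" by simp
      then have "\<gamma>2 ` {s + k..t + k} = (\<lambda>r. \<gamma>2 (r + k)) ` {s..t}" by (simp add: image_image del: image_add_atLeastAtMost')
      also have "\<dots> = ?\<gamma> ` {s..t}" using \<open>b \<le> s\<close> by (intro image_cong) (auto simp: right)
      finally show ?thesis .
    qed
    moreover have "{s + k<..<t + k} \<inter> P2 = {}"
    proof -
      have False if "r \<in> {s + k<..<t + k}" "r \<in> P2" for r
      proof -
        have "r - k \<in> {s<..<t} \<inter> ?P" using that by auto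
        with dis show False by blast
      qed
      then show ?thesis by blast
    qed
    ultimately have "C1_on_interval (s + k) (t + k) (chart_map c \<circ> \<gamma>2)"
      using that \<open>b \<le> s\<close> by (intro P2(2)) simp_all
    from C1_on_interval_shift[OF this] show ?thesis
      by (rule C1_on_interval_cong) (use \<open>b \<le> s\<close> right in simp)
  qed
  moreover have "finite ?P" using P1(1) P2(1) by simp
  ultimately show ?thesis
    unfolding piecewise_C1_curve_def by (intro conjI cont exI[of _ ?P] allI impI ballI) auto
qed

text \<open>The chart selected in the speed depends on the point \<open>\<gamma> t\<close> alone and
  the derivative on the germ at \<open>t\<close>. Hence a joined curve inherits the speed of its
  pieces everywhere except at the junction.\<close>

lemma curve_speed_germ:
  assumes "\<forall>\<^sub>F r in nhds t. \<gamma> r = \<gamma>' r"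
  shows "curve_speed \<A> g \<gamma> t = curve_speed \<A> g \<gamma>' t"
proof -
  have eq: "\<gamma> t = \<gamma>' t" using assms by (rule eventually_nhds_x_imp_x)
  have "vector_derivative (f \<circ> \<gamma>) (at t) = vector_derivative (f \<circ> \<gamma>') (at t)" for f :: "'a \<Rightarrow> real^'b"
    by (rule vector_derivative_cong_eq) (use assms in \<open>auto elim: eventually_mono\<close>)
  then show ?thesis unfolding curve_speed_def eq Let_def by simp
qed

lemma curve_speed_shift:
  fixes g :: "('a, 'n::finite) metric_tensor"
  shows "curve_speed \<A> g (\<lambda>r. \<gamma> (r + k)) t = curve_speed \<A> g \<gamma> (t + k)"
proof -
  have shift: "((\<lambda>r. r + l) has_vector_derivative 1) (at u)" for l u :: real
    by (auto intro!: derivative_eq_intros)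
  \<comment> \<open>An equivalence is needed: \<open>vector_derivative\<close> is a choice among all
    derivatives, so equal sets of derivatives give equal values even where none exists.\<close>
  have "((\<lambda>r. f (r + k)) has_vector_derivative D) (at t) \<longleftrightarrow> (f has_vector_derivative D) (at (t + k))"
    for f :: "real \<Rightarrow> real^'n" and D
  proof 
    assume "(f has_vector_derivative D) (at (t + k))"
    then show "((\<lambda>r. f (r + k)) has_vector_derivative D) (at t)"
      using vector_diff_chain_at[of "\<lambda>r. r + k" 1 t f D] shift[of k t]
      by (simp add: o_def)
  next
    assume "((\<lambda>r. f (r + k)) has_vector_derivative D) (at t)"
    then show "(f has_vector_derivative D) (at (t + k))"
      using vector_diff_chain_at[of "\<lambda>r. r + - k" 1 "t + k" "\<lambda>r. f (r + k)" D] shift[of "- k" "t + k"]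
      by (simp add: o_def)
  qed
  then have "vector_derivative (\<lambda>r. f (r + k)) (at t) = vector_derivative f (at (t + k))"
    for f :: "real \<Rightarrow> real^'n"
    by (simp add: vector_derivative_def)
  note vd = this[of "chart_map c \<circ> \<gamma>" for c :: "('a, 'n) corner_chart", unfolded o_def]
  show ?thesis by (simp add: curve_speed_def o_def vd)
qed

text \<open>The germ of the joined curve agrees with that of one piece except at \<open>b\<close>,
  and a single time is a null set.\<close>

lemma curve_length_join_le:
  assumes "a \<le> b" "b \<le> e"
  shows "curve_length \<A> g a e (join_curves b k \<gamma>1 \<gamma>2)
    \<le> curve_length \<A> g a b \<gamma>1 + curve_length \<A> g (b + k) (e + k) \<gamma>2"
proof -
  let ?\<gamma> = "join_curves b k \<gamma>1 \<gamma>2"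
  have Un: "{a..e} = {a..b} \<union> {b..e}" using assms by auto
  have "curve_length \<A> g a e ?\<gamma> \<le> (\<integral>\<^sup>+t\<in>{a..b}. ennreal (curve_speed \<A> g ?\<gamma> t) \<partial>lborel)
      + (\<integral>\<^sup>+t\<in>{b..e}. ennreal (curve_speed \<A> g ?\<gamma> t) \<partial>lborel)"
    unfolding curve_length_def Un by (rule set_nn_integral_Un_le) auto
  also have "(\<integral>\<^sup>+t\<in>{a..b}. ennreal (curve_speed \<A> g ?\<gamma> t) \<partial>lborel) = curve_length \<A> g a b \<gamma>1"
    unfolding curve_length_def
  proof (intro nn_integral_cong_AE)
    have speed: "curve_speed \<A> g ?\<gamma> t = curve_speed \<A> g \<gamma>1 t" if "t < b" for t
      by (rule curve_speed_germ) (use eventually_nhds_in_open[of "{..<b}" t] that in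
          \<open>auto elim!: eventually_mono simp: join_curves_def\<close>)
    show "AE t in lborel. ennreal (curve_speed \<A> g ?\<gamma> t) * indicator {a..b} t =
        ennreal (curve_speed \<A> g \<gamma>1 t) * indicator {a..b} t"
      using AE_lborel_singleton[of b] by eventually_elim (auto simp: speed indicator_def)
  qed
  also have "(\<integral>\<^sup>+t\<in>{b..e}. ennreal (curve_speed \<A> g ?\<gamma> t) \<partial>lborel)
      = (\<integral>\<^sup>+t. ennreal (curve_speed \<A> g \<gamma>2 (k + t)) * indicator {b + k..e + k} (k + t) \<partial>lborel)"
  proof (intro nn_integral_cong_AE)
    have speed: "curve_speed \<A> g ?\<gamma> t = curve_speed \<A> g \<gamma>2 (t + k)" if "b < t" for t
      unfolding curve_speed_shift[symmetric]
      by (rule curve_speed_germ) (use eventually_nhds_in_open[of "{b<..}" t] that in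
          \<open>auto elim!: eventually_mono simp: join_curves_def\<close>)
    show "AE t in lborel. ennreal (curve_speed \<A> g ?\<gamma> t) * indicator {b..e} t =
        ennreal (curve_speed \<A> g \<gamma>2 (k + t)) * indicator {b + k..e + k} (k + t)"
      using AE_lborel_singleton[of b] by eventually_elim (auto simp: speed indicator_def add.commute)
  qed
  also have "\<dots> \<le> curve_length \<A> g (b + k) (e + k) \<gamma>2"
    unfolding curve_length_def
    by (rule nn_integral_shift_le[where f = "\<lambda>t. ennreal (curve_speed \<A> g \<gamma>2 t) * indicator {b + k..e + k} t"])
  finally show ?thesis by (simp add: add_left_mono)
qed

section \<open>The triangle inequality for the Riemannian distance\<close>

lemma riemannian_distance_le:
  assumes "piecewise_C1_curve X \<A> M a b \<gamma>" "a \<le> b" "\<gamma> a = x" "\<gamma> b = y"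
  shows "riemannian_distance X \<A> M g x y \<le> curve_length \<A> g a b \<gamma>"
  unfolding riemannian_distance_def using assms by (intro Inf_lower) blast

text \<open>Each leg is approximated by a curve within \<open>\<epsilon> / 2\<close> of its infimum,
  and the two curves are joined. The case of an infinite right-hand side is discharged by
  \<open>ennreal_le_epsilon\<close>.\<close>

lemma riemannian_distance_triangle:
  "riemannian_distance X \<A> M g x z \<le> riemannian_distance X \<A> M g x y + riemannian_distance X \<A> M g y z"
proof (rule ennreal_le_epsilon)
  let ?d = "riemannian_distance X \<A> M g"
  fix \<epsilon> :: real
  assume fin: "?d x y + ?d y z < top" and "0 < \<epsilon>"
  have approx: "\<exists>a b \<gamma>. a \<le> b \<and> piecewise_C1_curve X \<A> M a b \<gamma> \<and> \<gamma> a = u \<and> \<gamma> b = v \<and>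
      curve_length \<A> g a b \<gamma> < ?d u v + ennreal (\<epsilon> / 2)" if "?d u v < top" for u v
  proof -
    \<comment> \<open>Strictness relies on \<open>?d u v\<close> being finite, since adding to
      \<open>top\<close> changes nothing.\<close>
    have "?d u v < ?d u v + ennreal (\<epsilon> / 2)"
      using that \<open>0 < \<epsilon>\<close>
      by (cases "?d u v" rule: ennreal_cases) (auto simp flip: ennreal_plus simp: ennreal_less_iff)
    then have "\<exists>l\<in>{curve_length \<A> g a b \<gamma> | a b \<gamma>.
            a \<le> b \<and> piecewise_C1_curve X \<A> M a b \<gamma> \<and> \<gamma> a = u \<and> \<gamma> b = v}. l < ?d u v + ennreal (\<epsilon> / 2)"
      by (simp only: riemannian_distance_def Inf_less_iff)
    then show ?thesis by blast
  qed
  have "?d x y < top" "?d y z < top" using fin by (auto simp: less_top)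
  with approx[of x y] approx[of y z] obtain a b \<gamma>1 c e \<gamma>2 where
    1: "a \<le> b" "piecewise_C1_curve X \<A> M a b \<gamma>1" "\<gamma>1 a = x" "\<gamma>1 b = y"
      "curve_length \<A> g a b \<gamma>1 < ?d x y + ennreal (\<epsilon> / 2)" and
    2: "c \<le> e" "piecewise_C1_curve X \<A> M c e \<gamma>2" "\<gamma>2 c = y" "\<gamma>2 e = z"
      "curve_length \<A> g c e \<gamma>2 < ?d y z + ennreal (\<epsilon> / 2)"
    by metis
  define k where "k = c - b"
  have k: "b + k = c" "(e - k) + k = e" "b \<le> e - k" using 2(1) by (auto simp: k_def)
  let ?\<gamma> = "join_curves b k \<gamma>1 \<gamma>2"
  have "?d x z \<le> curve_length \<A> g a (e - k) ?\<gamma>"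
  proof (rule riemannian_distance_le)
    show "piecewise_C1_curve X \<A> M a (e - k) ?\<gamma>"
      using 1 2 k by (intro piecewise_C1_curve_join) auto
    \<comment> \<open>If \<open>c = e\<close>, the joined curve still ends on its first branch; in
      that case \<open>y = z\<close>.\<close>
    show "?\<gamma> (e - k) = z"
      using 1 2 k by (cases "e - k \<le> b") (auto simp: join_curves_def)
  qed (use 1 2 k in \<open>auto simp: join_curves_def\<close>)
  also have "\<dots> \<le> curve_length \<A> g a b \<gamma>1 + curve_length \<A> g c e \<gamma>2"
    using curve_length_join_le[OF 1(1) k(3), of \<A> g k \<gamma>1 \<gamma>2] k by simp
  also have "\<dots> \<le> (?d x y + ennreal (\<epsilon> / 2)) + (?d y z + ennreal (\<epsilon> / 2))"
    using 1(5) 2(5) by (intro add_mono) auto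
  also have "\<dots> = ?d x y + ?d y z + (ennreal (\<epsilon> / 2) + ennreal (\<epsilon> / 2))"
    by (simp add: ac_simps)
  also have "ennreal (\<epsilon> / 2) + ennreal (\<epsilon> / 2) = ennreal \<epsilon>"
    using \<open>0 < \<epsilon>\<close> by (simp flip: ennreal_plus)
  finally show "?d x z \<le> ?d x y + ?d y z + ennreal \<epsilon>" .
qed

subsection \<open>Charts and curves in charts\<close>

text \<open>The interior of the model quadrant. Being open in Euclidean space, it is where ordinary
  two-sided derivatives and invariance of domain are available.\<close>

definition pos_quadrant :: "'n set \<Rightarrow> (real^'n::finite) set" where
  "pos_quadrant K = {x. \<forall>i\<in>K. 0 < x $ i}"

lemma pos_quadrant_subset: "pos_quadrant K \<subseteq> quadrant K"
  by (auto simp: pos_quadrant_def quadrant_def less_imp_le)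

lemma open_pos_quadrant: "open (pos_quadrant K)"
proof -
  have "pos_quadrant K = (\<Inter>i\<in>K. {x. 0 < x $ i})" by (auto simp: pos_quadrant_def)
  then show ?thesis by (auto intro!: open_INT open_Collect_less continuous_intros)
qed

lemma open_Int_pos_quadrant:
  assumes "openin (top_of_set (quadrant K)) S"
  shows "open (S \<inter> pos_quadrant K)"
proof -
  obtain U where U: "open U" "S = quadrant K \<inter> U" using assms by (auto simp: openin_open)
  then have "S \<inter> pos_quadrant K = U \<inter> pos_quadrant K" using pos_quadrant_subset by blast
  with U(1) open_pos_quadrant[of K] show ?thesis by auto
qed

section \<open>Regularity of maps that are smooth on sets which need not be open\<close>

lemma smooth_on_local_C1:
  assumes "smooth_on S f" "x \<in> S"
  obtains U F where "open U" "x \<in> U" "\<And>y. y \<in> U \<Longrightarrow> F differentiable (at y)"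
    "\<And>v. continuous_on U (\<lambda>y. frechet_derivative F (at y) v)" "\<And>y. y \<in> U \<inter> S \<Longrightarrow> F y = f y"
proof -
  obtain U F where U: "open U" "x \<in> U" "\<forall>k. Ck_on_open k U F" "\<forall>y\<in>U \<inter> S. F y = f y"
    using bspec[OF assms(1)[unfolded smooth_on_def] assms(2)] by metis
  have "Ck_on_open (Suc 0) U F" using U(3) by blast
  then have "\<forall>y\<in>U. F differentiable (at y)" "\<forall>v. continuous_on U (\<lambda>y. frechet_derivative F (at y) v)"
    by simp_all
  with U(1,2,4) show thesis by (intro that[of U F]) blast+
qed

text \<open>On an open part of \<open>S\<close>, a local extension coincides with \<open>f\<close>
  on a whole neighbourhood, so both have the same derivative; at a boundary point of
  \<open>S\<close> this would fail.\<close>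

lemma smooth_on_imp_C1_on_open:
  assumes "smooth_on S f" "open W" "W \<subseteq> S"
  shows "\<forall>x\<in>W. f differentiable at x"
    and "continuous_on W (\<lambda>x. frechet_derivative f (at x) v)"
proof -
  have loc: "\<exists>V F. open V \<and> x \<in> V \<and> V \<subseteq> W \<and> (\<forall>y\<in>V. F y = f y) \<and>
      (\<forall>y\<in>V. F differentiable at y) \<and> (\<forall>v. continuous_on V (\<lambda>y. frechet_derivative F (at y) v))"
    if "x \<in> W" for x
  proof -
    have x: "x \<in> S" using assms(3) \<open>x \<in> W\<close> by blast
    obtain U F where U: "open U" "x \<in> U" "\<And>y. y \<in> U \<Longrightarrow> F differentiable (at y)"
      "\<And>v. continuous_on U (\<lambda>y. frechet_derivative F (at y) v)" "\<And>y. y \<in> U \<inter> S \<Longrightarrow> F y = f y"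
      using smooth_on_local_C1[OF assms(1) x] by metis
    have "continuous_on (U \<inter> W) (\<lambda>y. frechet_derivative F (at y) v)" for v
      using continuous_on_subset[OF U(4)] by blast
    moreover have "\<forall>y\<in>U \<inter> W. F y = f y" using U(5) assms(3) by blast
    ultimately show ?thesis
      using U(1,2,3) assms(2) that by (intro exI[of _ "U \<inter> W"] exI[of _ F]) auto
  qed
  have der: "(f has_derivative frechet_derivative F (at y)) (at y)"
    if "open V" "y \<in> V" "\<forall>y\<in>V. F y = f y" "\<forall>y\<in>V. F differentiable at y" for V F y
    using that by (intro has_derivative_transform_within_open[of F _ y UNIV V f])
      (auto simp: frechet_derivative_works)
  show "\<forall>x\<in>W. f differentiable at x"
    using loc der unfolding differentiable_def by metis
  have "continuous (at x) (\<lambda>x. frechet_derivative f (at x) v)" if "x \<in> W" for x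
  proof -
    obtain V F where V: "open V" "x \<in> V" "\<forall>y\<in>V. F y = f y" "\<forall>y\<in>V. F differentiable at y"
      "continuous_on V (\<lambda>y. frechet_derivative F (at y) v)"
      using loc[OF \<open>x \<in> W\<close>] by metis
    have "frechet_derivative f (at y) = frechet_derivative F (at y)" if "y \<in> V" for y
      using frechet_derivative_at[OF der[OF V(1) that V(3,4)]] by simp
    then have "continuous_on V (\<lambda>y. frechet_derivative f (at y) v)"
      using V(5) by (simp cong: continuous_on_cong)
    with V show ?thesis by (simp add: continuous_on_eq_continuous_at)
  qed
  then show "continuous_on W (\<lambda>x. frechet_derivative f (at x) v)"
    by (intro continuous_at_imp_continuous_on ballI)
qed

lemma smooth_on_imp_continuous_on:
  assumes "smooth_on S f" shows "continuous_on S f"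
  unfolding continuous_on_eq_continuous_within
proof
  fix x assume x: "x \<in> S"
  obtain U F where U: "open U" "x \<in> U" "\<And>y. y \<in> U \<Longrightarrow> F differentiable (at y)" "\<And>y. y \<in> U \<inter> S \<Longrightarrow> F y = f y"
    using smooth_on_local_C1[OF assms x] by metis
  obtain r where r: "0 < r" "ball x r \<subseteq> U" using U(1,2) open_contains_ball by blast
  have "continuous (at x within S) F"
    using differentiable_imp_continuous_within[OF U(3)[OF U(2)]] continuous_at_imp_continuous_at_within by blast
  then show "continuous (at x within S) f"
    by (rule continuous_transform_within[OF _ r(1) x])
      (use r(2) in \<open>auto intro!: U(4) simp: dist_commute subset_iff\<close>)
qed

lemma eventually_nhds_continuous_on:
  assumes "continuous_on S f" "x \<in> S" "open T" "f x \<in> T"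
  shows "\<forall>\<^sub>F y in nhds x. y \<in> S \<longrightarrow> f y \<in> T"
proof -
  obtain A where "open A" "x \<in> A" "\<forall>y\<in>S. y \<in> A \<longrightarrow> f y \<in> T"
    using assms unfolding continuous_on_topological by meson
  then show ?thesis unfolding eventually_nhds by blast
qed

text \<open>The sum metric is in general not smooth up to the boundary, so it is no
  \<open>riemannian_metric\<close> on all of \<open>X\<close>. The transformation law survives
  multiplication by a function of the point, and on the diagonal it is what makes the speed
  independent of the chart.\<close>

definition transforms_as_tensor ::
    "('a, 'n::finite) corner_chart set \<Rightarrow> ('a, 'n) metric_tensor \<Rightarrow> bool" where
  "transforms_as_tensor \<A> g \<longleftrightarrow>
     (\<forall>c\<in>\<A>. \<forall>c'\<in>\<A>. \<forall>p\<in>chart_dom c \<inter> chart_dom c'. \<forall>D.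
        (chart_transition c c' has_derivative D)
          (at (chart_map c p) within chart_map c ` (chart_dom c \<inter> chart_dom c')) \<longrightarrow>
        (\<forall>u. g c p u u = g c' p (D u) (D u)))"

lemma transforms_as_tensor_sum_metric:
  assumes "riemannian_metric \<A> g"
  shows "transforms_as_tensor \<A> (sum_metric N \<rho> \<alpha> g)"
proof -
  have "transforms_as_tensor \<A> g"
    using assms by (simp add: riemannian_metric_def transforms_as_tensor_def)
  then show ?thesis by (simp add: transforms_as_tensor_def sum_metric_def)
qed

locale corner_manifold =
  fixes X :: "'a topology" and \<A> :: "('a, 'n::finite) corner_chart set"
  assumes mfd: "manifold_with_corners X \<A>"
begin

lemma is_chart: "c \<in> \<A> \<Longrightarrow> is_corner_chart X c"
  using mfd by (auto simp: manifold_with_corners_def)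

lemma chart_at:
  assumes "p \<in> topspace X" obtains c where "c \<in> \<A>" "p \<in> chart_dom c"
proof -
  have "topspace X = (\<Union>c\<in>\<A>. chart_dom c)" using mfd by (simp add: manifold_with_corners_def)
  with assms that show thesis by blast
qed

lemma openin_chart_dom: "c \<in> \<A> \<Longrightarrow> openin X (chart_dom c)"
  using is_chart by (auto simp: is_corner_chart_def)

lemma homeomorphic_chart:
  "c \<in> \<A> \<Longrightarrow> homeomorphic_map (subtopology X (chart_dom c)) (top_of_set (chart_map c ` chart_dom c)) (chart_map c)"
  using is_chart by (auto simp: is_corner_chart_def)

lemma topspace_chart_dom: "c \<in> \<A> \<Longrightarrow> topspace (subtopology X (chart_dom c)) = chart_dom c"
  using openin_subset[OF openin_chart_dom] by auto

lemma inj_on_chart_map: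
  assumes "c \<in> \<A>" shows "inj_on (chart_map c) (chart_dom c)"
  using homeomorphic_imp_injective_map[OF homeomorphic_chart[OF assms]] topspace_chart_dom[OF assms]
  by simp

lemma chart_inv_chart_map [simp]: "c \<in> \<A> \<Longrightarrow> q \<in> chart_dom c \<Longrightarrow> chart_inv c (chart_map c q) = q"
  by (simp add: chart_inv_def inj_on_chart_map)

lemma chart_map_chart_inv [simp]: "x \<in> chart_map c ` chart_dom c \<Longrightarrow> chart_map c (chart_inv c x) = x"
  by (simp add: chart_inv_def f_inv_into_f)

lemma chart_inv_in_dom: "x \<in> chart_map c ` chart_dom c \<Longrightarrow> chart_inv c x \<in> chart_dom c"
  by (simp add: chart_inv_def inv_into_into)

lemma chart_dom_subset: "c \<in> \<A> \<Longrightarrow> chart_dom c \<subseteq> topspace X"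
  using openin_subset openin_chart_dom by blast

lemma openin_chart_image:
  assumes "c \<in> \<A>" "openin X V" "V \<subseteq> chart_dom c"
  shows "openin (top_of_set (quadrant (chart_walls c))) (chart_map c ` V)"
proof -
  have "openin (subtopology X (chart_dom c)) V"
    using assms openin_chart_dom openin_open_subtopology by blast
  then have "openin (top_of_set (chart_map c ` chart_dom c)) (chart_map c ` V)"
    using homeomorphic_imp_open_map[OF homeomorphic_chart[OF assms(1)]] by (auto simp: open_map_def)
  moreover have "openin (top_of_set (quadrant (chart_walls c))) (chart_map c ` chart_dom c)"
    using is_chart[OF assms(1)] by (simp add: is_corner_chart_def)
  ultimately show ?thesis by (rule openin_trans)
qed

lemma chart_image_subset_quadrant: "c \<in> \<A> \<Longrightarrow> chart_map c ` chart_dom c \<subseteq> quadrant (chart_walls c)"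
  using openin_imp_subset[OF openin_chart_image[OF _ openin_chart_dom]] by blast

lemma continuous_map_chart_inv:
  assumes "c \<in> \<A>" shows "continuous_map (top_of_set (chart_map c ` chart_dom c)) X (chart_inv c)"
proof -
  obtain h where h: "homeomorphic_maps (subtopology X (chart_dom c)) (top_of_set (chart_map c ` chart_dom c)) (chart_map c) h"
    using homeomorphic_chart[OF assms] homeomorphic_map_maps by blast
  then have "continuous_map (top_of_set (chart_map c ` chart_dom c)) X h"
    by (auto simp: homeomorphic_maps_def continuous_map_in_subtopology)
  moreover have "h x = chart_inv c x" if "x \<in> chart_map c ` chart_dom c" for x
    using h that topspace_chart_dom[OF assms] assms by (auto simp: homeomorphic_maps_def)
  ultimately show ?thesis by (rule continuous_map_eq) simp
qed

lemma continuous_map_chart_map: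
  "c \<in> \<A> \<Longrightarrow> continuous_map (subtopology X (chart_dom c)) euclidean (chart_map c)"
  using homeomorphic_imp_continuous_map[OF homeomorphic_chart] by (auto simp: continuous_map_in_subtopology)

lemma continuous_on_chart_transition:
  assumes "c \<in> \<A>" "c' \<in> \<A>"
  shows "continuous_on (chart_map c ` (chart_dom c \<inter> chart_dom c')) (chart_transition c c')"
proof -
  let ?S = "chart_map c ` (chart_dom c \<inter> chart_dom c')"
  have "continuous_map (top_of_set ?S) X (chart_inv c)"
    by (rule continuous_map_from_subtopology_mono[OF continuous_map_chart_inv[OF assms(1)]]) auto
  then have "continuous_map (top_of_set ?S) (subtopology X (chart_dom c')) (chart_inv c)"
    using assms(1) by (auto simp: continuous_map_in_subtopology)
  from continuous_map_compose[OF this continuous_map_chart_map[OF assms(2)]]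
  show ?thesis by (simp add: chart_transition_def)
qed

lemma chart_map_interior_pos:
  assumes "c \<in> \<A>" "q \<in> chart_dom c" "q \<in> mfd_interior X \<A>"
  shows "chart_map c q \<in> pos_quadrant (chart_walls c)"
proof -
  have "active_walls c q = {}" using assms by (auto simp: mfd_interior_def mfd_boundary_def)
  moreover have "chart_map c q \<in> quadrant (chart_walls c)"
    using assms chart_image_subset_quadrant by blast
  ultimately show ?thesis by (force simp: active_walls_def quadrant_def pos_quadrant_def)
qed

text \<open>By invariance of domain, no chart can map a point with positive wall coordinates to the
  boundary of its quadrant.\<close>

lemma chart_inv_pos_interior:
  assumes c: "c \<in> \<A>" and x: "x \<in> chart_map c ` chart_dom c" "x \<in> pos_quadrant (chart_walls c)"
  shows "chart_inv c x \<in> mfd_interior X \<A>"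
proof -
  have "active_walls c' (chart_inv c x) = {}" if c': "c' \<in> \<A>" and dom: "chart_inv c x \<in> chart_dom c'" for c'
  proof (rule ccontr)
    assume "active_walls c' (chart_inv c x) \<noteq> {}"
    then obtain j where j: "j \<in> chart_walls c'" "chart_map c' (chart_inv c x) $ j = 0"
      by (auto simp: active_walls_def)
    \<comment> \<open>The image of the overlap is open only relative to the quadrant; cutting it
      down to the positive quadrant makes it open in Euclidean space.\<close>
    let ?W = "chart_map c ` (chart_dom c \<inter> chart_dom c') \<inter> pos_quadrant (chart_walls c)"
    let ?\<tau> = "chart_transition c c'"
    have "open ?W"
      using c c' by (intro open_Int_pos_quadrant openin_chart_image openin_Int openin_chart_dom) auto
    moreover have "continuous_on ?W ?\<tau>"
      using continuous_on_subset[OF continuous_on_chart_transition[OF c c']] by blast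
    moreover have "inj_on ?\<tau> ?W"
    proof (rule inj_onI)
      fix u v assume u: "u \<in> ?W" and v: "v \<in> ?W" and eq: "?\<tau> u = ?\<tau> v"
      then obtain p q where pq: "p \<in> chart_dom c \<inter> chart_dom c'" "u = chart_map c p"
        "q \<in> chart_dom c \<inter> chart_dom c'" "v = chart_map c q" by blast
      then have "chart_map c' p = chart_map c' q"
        using eq c by (simp add: chart_transition_def)
      then show "u = v" using pq inj_on_chart_map[OF c'] by (auto dest: inj_onD)
    qed
    ultimately have "open (?\<tau> ` ?W)" by (intro invariance_of_domain)
    moreover have "x \<in> ?W" using x dom c by force
    ultimately obtain e where e: "0 < e" "ball (?\<tau> x) e \<subseteq> ?\<tau> ` ?W"
      by (meson imageI open_contains_ball)
    \<comment> \<open>The image \<open>?\<tau> x\<close> lies on wall \<open>j\<close> of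
      \<open>c'\<close>. A small step against the inward normal stays in the open image but leaves
      the quadrant.\<close>
    define y where "y = ?\<tau> x - (e/2) *\<^sub>R axis j 1"
    have "y \<in> ball (?\<tau> x) e" using e(1) by (simp add: y_def dist_norm)
    then have "y \<in> ?\<tau> ` ?W" using e(2) by blast
    also have "\<dots> \<subseteq> quadrant (chart_walls c')"
      using c chart_image_subset_quadrant[OF c'] by (auto simp: chart_transition_def)
    finally have "0 \<le> y $ j" using j by (simp add: quadrant_def)
    moreover have "y $ j = - (e/2)" using j by (simp add: y_def chart_transition_def)
    ultimately show False using e(1) by simp
  qed
  moreover have "chart_inv c x \<in> topspace X"
    using chart_inv_in_dom[OF x(1)] chart_dom_subset[OF c] by blast
  ultimately show ?thesis by (auto simp: mfd_interior_def mfd_boundary_def)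
qed

section \<open>Interior curves prescribed by their coordinates in one chart\<close>

context
  fixes c :: "('a, 'n) corner_chart" and a b :: real and \<kappa> \<kappa>' :: "real \<Rightarrow> real^'n"
  assumes c: "c \<in> \<A>"
    and \<kappa>: "\<And>t. t \<in> {a..b} \<Longrightarrow> \<kappa> t \<in> chart_map c ` chart_dom c \<inter> pos_quadrant (chart_walls c)"
    and der: "\<And>t. (\<kappa> has_vector_derivative \<kappa>' t) (at t)"
    and cont': "continuous_on {a..b} \<kappa>'"
begin

text \<open>Positive wall coordinates place \<open>\<kappa> t\<close> in an open part of the
  overlap, so the transition map has a full derivative there. As \<open>der\<close> is two-sided at
  every time, the chain rule also covers the end points.\<close>

lemma transition_curve:
  assumes c': "c' \<in> \<A>" and t: "t \<in> {a..b}" "chart_inv c (\<kappa> t) \<in> chart_dom c'"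
  shows "(chart_transition c c' has_derivative frechet_derivative (chart_transition c c') (at (\<kappa> t))) (at (\<kappa> t))"
    and "((chart_map c' \<circ> (chart_inv c \<circ> \<kappa>)) has_vector_derivative
      frechet_derivative (chart_transition c c') (at (\<kappa> t)) (\<kappa>' t)) (at t)"
proof -
  let ?S = "chart_map c ` (chart_dom c \<inter> chart_dom c')"
  let ?W = "?S \<inter> pos_quadrant (chart_walls c)" and ?\<tau> = "chart_transition c c'"
  have W: "open ?W"
    using c c' by (intro open_Int_pos_quadrant openin_chart_image openin_Int openin_chart_dom) auto
  have sm: "smooth_on ?S ?\<tau>" using mfd c c' by (auto simp: manifold_with_corners_def)
  have "\<kappa> t \<in> ?W" using \<kappa>[OF t(1)] t(2) c by force
  then have "?\<tau> differentiable at (\<kappa> t)" using smooth_on_imp_C1_on_open(1)[OF sm W] by auto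
  then show 1: "(?\<tau> has_derivative frechet_derivative ?\<tau> (at (\<kappa> t))) (at (\<kappa> t))"
    by (simp add: frechet_derivative_works)
  show "((chart_map c' \<circ> (chart_inv c \<circ> \<kappa>)) has_vector_derivative
      frechet_derivative ?\<tau> (at (\<kappa> t)) (\<kappa>' t)) (at t)"
    using vector_derivative_diff_chain_within[OF der has_derivative_at_withinI[OF 1]]
    by (simp add: chart_transition_def o_def)
qed

lemma piecewise_C1_chart_curve:
  shows "piecewise_C1_curve X \<A> (mfd_interior X \<A>) a b (chart_inv c \<circ> \<kappa>)"
proof -
  have cont: "continuous_on S \<kappa>" for S
    by (intro continuous_at_imp_continuous_on ballI has_vector_derivative_continuous[OF der])
  have "continuous_map (top_of_set {a..b}) (top_of_set (chart_map c ` chart_dom c)) \<kappa>"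
    using cont \<kappa> by (auto simp: continuous_map_in_subtopology)
  from continuous_map_compose[OF this continuous_map_chart_inv[OF c]]
  have 1: "continuous_map (top_of_set {a..b}) (subtopology X (mfd_interior X \<A>)) (chart_inv c \<circ> \<kappa>)"
    using \<kappa> chart_inv_pos_interior[OF c] by (auto simp: continuous_map_in_subtopology)
  have 2: "C1_on_interval s t (chart_map c' \<circ> (chart_inv c \<circ> \<kappa>))"
    if st: "a \<le> s" "t \<le> b" and c': "c' \<in> \<A>" and sub: "(chart_inv c \<circ> \<kappa>) ` {s..t} \<subseteq> chart_dom c'" for s t c'
  proof -
    let ?S = "chart_map c ` (chart_dom c \<inter> chart_dom c')"
    let ?W = "?S \<inter> pos_quadrant (chart_walls c)" and ?\<tau> = "chart_transition c c'"
    let ?D = "\<lambda>t. frechet_derivative ?\<tau> (at (\<kappa> t))"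
    have W: "open ?W"
      using c c' by (intro open_Int_pos_quadrant openin_chart_image openin_Int openin_chart_dom) auto
    have sm: "smooth_on ?S ?\<tau>" using mfd c c' by (auto simp: manifold_with_corners_def)
    have inW: "\<kappa> r \<in> ?W" if "r \<in> {s..t}" for r
    proof -
      have "r \<in> {a..b}" "chart_inv c (\<kappa> r) \<in> chart_dom c'" using that st sub by auto
      with \<kappa>[of r] c show ?thesis by force
    qed
    have ab: "r \<in> {a..b}" "chart_inv c (\<kappa> r) \<in> chart_dom c'" if "r \<in> {s..t}" for r
      using that st sub by auto
    \<comment> \<open>The derivative of the transition is known to depend continuously on the point
      for each fixed direction, whereas \<open>\<kappa>' r\<close> varies. Expanding in the basis
      reduces to fixed directions.\<close>
    have eq: "?D r (\<kappa>' r) = (\<Sum>v\<in>Basis. (\<kappa>' r \<bullet> v) *\<^sub>R ?D r v)" if "r \<in> {s..t}" for r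
    proof -
      interpret linear "?D r" using transition_curve(1)[OF c' ab[OF that]] by (rule has_derivative_linear)
      have "?D r (\<Sum>v\<in>Basis. (\<kappa>' r \<bullet> v) *\<^sub>R v) = (\<Sum>v\<in>Basis. (\<kappa>' r \<bullet> v) *\<^sub>R ?D r v)"
        by (simp add: sum scaleR)
      then show ?thesis by (simp add: euclidean_representation)
    qed
    have "continuous_on {s..t} (\<lambda>r. \<Sum>v\<in>Basis. (\<kappa>' r \<bullet> v) *\<^sub>R ?D r v)"
    proof (intro continuous_intros)
      show "continuous_on {s..t} \<kappa>'" using continuous_on_subset[OF cont'] st by auto
      fix v show "continuous_on {s..t} (\<lambda>r. ?D r v)"
        using inW by (intro continuous_on_compose2[OF smooth_on_imp_C1_on_open(2)[OF sm W] cont]) auto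
    qed
    then have "continuous_on {s..t} (\<lambda>r. ?D r (\<kappa>' r))"
      by (rule continuous_on_eq) (rule eq[symmetric])
    then show ?thesis
      unfolding C1_on_interval_def
      using transition_curve(2)[OF c' ab] by (blast intro: has_vector_derivative_at_within)
  qed
  show ?thesis
    unfolding piecewise_C1_curve_def by (intro conjI 1 exI[of _ "{}"]) (auto intro!: 2)
qed

text \<open>The speed picks a chart independently at each time, with no regularity in
  \<open>t\<close>. The transformation law carries every value back to the fixed chart
  \<open>c\<close>, where it can be estimated.\<close>

lemma curve_speed_chart_curve:
  fixes g :: "('a, 'n) metric_tensor"
  assumes law: "transforms_as_tensor \<A> g"
    and t: "t \<in> {a..b}"
  shows "curve_speed \<A> g (chart_inv c \<circ> \<kappa>) t = sqrt (g c (chart_inv c (\<kappa> t)) (\<kappa>' t) (\<kappa>' t))"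
proof -
  let ?q = "chart_inv c (\<kappa> t)"
  define c' where "c' = (SOME c. c \<in> \<A> \<and> ?q \<in> chart_dom c)"
  let ?D = "frechet_derivative (chart_transition c c') (at (\<kappa> t))"
  have dom: "?q \<in> chart_dom c" using \<kappa>[OF t] by (intro chart_inv_in_dom) (rule IntD1)
  have "c' \<in> \<A> \<and> ?q \<in> chart_dom c'"
    unfolding c'_def by (rule someI[of _ c]) (use c dom in blast)
  then have c': "c' \<in> \<A>" "?q \<in> chart_dom c'" by blast+
  have "chart_map c ?q = \<kappa> t" using \<kappa>[OF t] by simp
  then have "(chart_transition c c' has_derivative ?D)
      (at (chart_map c ?q) within chart_map c ` (chart_dom c \<inter> chart_dom c'))"
    using has_derivative_at_withinI[OF transition_curve(1)[OF c'(1) t c'(2)]] by metis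
  then have "g c ?q (\<kappa>' t) (\<kappa>' t) = g c' ?q (?D (\<kappa>' t)) (?D (\<kappa>' t))"
    using law dom c c' unfolding transforms_as_tensor_def by blast
  moreover have "vector_derivative (chart_map c' \<circ> (chart_inv c \<circ> \<kappa>)) (at t) = ?D (\<kappa>' t)"
    using transition_curve(2)[OF c'(1) t c'(2)] by (rule vector_derivative_at)
  moreover have "curve_speed \<A> g (chart_inv c \<circ> \<kappa>) t =
      sqrt (g c' ?q (vector_derivative (chart_map c' \<circ> (chart_inv c \<circ> \<kappa>)) (at t))
        (vector_derivative (chart_map c' \<circ> (chart_inv c \<circ> \<kappa>)) (at t)))"
    unfolding curve_speed_def Let_def c'_def o_apply ..
  ultimately show ?thesis by metis
qed

end

end

subsection \<open>Bounds for the sum metric near a point\<close>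

text \<open>For \<open>h \<le> 1\<close> the larger exponent dominates, so different weights can all
  be measured against the same power of \<open>h\<close>.\<close>

lemma powr_le_scaled:
  fixes m h r \<alpha> M :: real
  assumes "0 < m" "0 < h" "h \<le> 1" "0 \<le> \<alpha>" "\<alpha> \<le> M" "m * h \<le> r"
  shows "r powr (- \<alpha>) \<le> m powr (- \<alpha>) * h powr (- M)"
proof -
  have "r powr (- \<alpha>) \<le> (m * h) powr (- \<alpha>)"
    using assms by (intro powr_mono2') auto
  also have "\<dots> = m powr (- \<alpha>) * h powr (- \<alpha>)" using assms by (simp add: powr_mult)
  also have "\<dots> \<le> m powr (- \<alpha>) * h powr (- M)"
    using assms by (intro mult_left_mono powr_mono') auto
  finally show ?thesis .
qed

context corner_manifold
begin

text \<open>The chart image is relatively open, so close to the image of \<open>p\<close> membership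
  in it reduces to membership in the quadrant. Therefore the local bounds below are all guarded by
  the quadrant.\<close>

lemma eventually_in_chart_image:
  assumes "c \<in> \<A>" "p \<in> chart_dom c"
  shows "\<forall>\<^sub>F x in nhds (chart_map c p). x \<in> quadrant (chart_walls c) \<longrightarrow> x \<in> chart_map c ` chart_dom c"
proof -
  obtain V where V: "open V" "chart_map c ` chart_dom c = quadrant (chart_walls c) \<inter> V"
    using openin_chart_image[OF assms(1) openin_chart_dom[OF assms(1)] order_refl] by (auto simp: openin_open)
  then have "chart_map c p \<in> V" using assms by blast
  with V show ?thesis unfolding eventually_nhds by (intro exI[of _ V]) auto
qed

lemma eventually_bdf_away_from_face:
  assumes c: "c \<in> \<A>" and p: "p \<in> chart_dom c" "p \<notin> H"
    and bdf: "boundary_defining_function X \<A> H \<rho>"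
  shows "\<exists>m>0. \<forall>\<^sub>F x in nhds (chart_map c p). x \<in> quadrant (chart_walls c) \<longrightarrow> m \<le> \<rho> (chart_inv c x)"
proof -
  let ?S = "chart_map c ` chart_dom c"
  have "p \<in> topspace X" using p chart_dom_subset[OF c] by blast
  then have pos: "0 < \<rho> p" using bdf p by (auto simp: boundary_defining_function_def)
  have "smooth_on ?S (\<rho> \<circ> chart_inv c)"
    using bdf c by (auto simp: boundary_defining_function_def smooth_function_def)
  from eventually_nhds_continuous_on[OF smooth_on_imp_continuous_on[OF this], of "chart_map c p" "{\<rho> p / 2<..}"]
  have "\<forall>\<^sub>F x in nhds (chart_map c p). x \<in> ?S \<longrightarrow> \<rho> p / 2 < \<rho> (chart_inv c x)"
    using p c pos by simp
  with eventually_in_chart_image[OF c p(1)]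
  have "\<forall>\<^sub>F x in nhds (chart_map c p). x \<in> quadrant (chart_walls c) \<longrightarrow> \<rho> p / 2 \<le> \<rho> (chart_inv c x)"
    by eventually_elim auto
  with pos show ?thesis by (intro exI[of _ "\<rho> p / 2"]) auto
qed

text \<open>Since \<open>\<rho>\<close> is nonnegative and vanishes at \<open>p\<close>, its nonzero differential is nonnegative on the
  tangent quadrant, so it is positive on some inward wall normal \<open>e\<^sub>j\<close>; integrate along \<open>e\<^sub>j\<close>.\<close>

lemma eventually_bdf_at_face:
  assumes c: "c \<in> \<A>" and p: "p \<in> chart_dom c" "p \<in> H"
    and bdf: "boundary_defining_function X \<A> H \<rho>"
  shows "\<exists>j\<in>chart_walls c. \<exists>m>0. \<forall>\<^sub>F x in nhds (chart_map c p).
    x \<in> quadrant (chart_walls c) \<longrightarrow> m * x $ j \<le> \<rho> (chart_inv c x)"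
proof -
  let ?K = "chart_walls c" and ?S = "chart_map c ` chart_dom c"
  let ?f = "\<rho> \<circ> chart_inv c"
  define x0 where "x0 = chart_map c p"
  have x0S: "x0 \<in> ?S" using p by (simp add: x0_def)
  then have x0Q: "x0 \<in> quadrant ?K" using chart_image_subset_quadrant[OF c] by blast
  have f0: "?f x0 = 0" using bdf p c by (auto simp: boundary_defining_function_def x0_def)
  have fnonneg: "0 \<le> ?f x" if "x \<in> ?S" for x
    using bdf chart_inv_in_dom[OF that] chart_dom_subset[OF c] by (auto simp: boundary_defining_function_def)
  have sm: "smooth_on ?S ?f"
    using bdf c by (auto simp: boundary_defining_function_def smooth_function_def)
  obtain U F where U: "open U" "x0 \<in> U" "\<And>y. y \<in> U \<Longrightarrow> F differentiable (at y)"
    "\<And>v. continuous_on U (\<lambda>y. frechet_derivative F (at y) v)" "\<And>y. y \<in> U \<inter> ?S \<Longrightarrow> F y = ?f y"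
    using smooth_on_local_C1[OF sm x0S] by metis
  have Fder: "(F has_derivative frechet_derivative F (at y)) (at y)" if "y \<in> U" for y
    using U(3)[OF that] by (simp add: frechet_derivative_works)
  have "\<forall>\<^sub>F x in nhds x0. x \<in> U \<and> (x \<in> quadrant ?K \<longrightarrow> x \<in> ?S)"
    using eventually_in_chart_image[OF c p(1)] eventually_nhds_in_open[OF U(1,2)]
    by (auto simp: x0_def eventually_conj_iff)
  then obtain r where r: "0 < r" "\<And>x. dist x x0 < r \<Longrightarrow> x \<in> U \<and> (x \<in> quadrant ?K \<longrightarrow> x \<in> ?S)"
    unfolding eventually_nhds_metric by blast
  \<comment> \<open>The extension \<open>F\<close> may be negative outside the quadrant, so each
    sign argument below has to check that its test points stay inside.\<close>
  have Fnonneg: "0 \<le> F x" if "dist x x0 < r" "x \<in> quadrant ?K" for x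
    using r(2)[OF that(1)] that(2) U(5)[of x] fnonneg[of x] by auto
  have F0: "F x0 = 0" using U(2,5) x0S f0 by auto
  let ?D = "frechet_derivative F (at x0)"
  interpret D: linear ?D using Fder[OF U(2)] by (rule has_derivative_linear)
  have step: "dist (x0 + t *\<^sub>R axis k 1) x0 < r" if "\<bar>t\<bar> < r" for t k
    using that by (simp add: dist_norm)
  have step_quadrant: "x0 + t *\<^sub>R axis k 1 \<in> quadrant ?K" if "0 \<le> t \<or> k \<notin> ?K \<or> \<bar>t\<bar> \<le> x0 $ k" for t k
    using x0Q that by (auto simp: quadrant_def axis_def)
  \<comment> \<open>The nonzero differential is given within the chart image. It must equal
    \<open>?D\<close>, because small positive steps along each coordinate axis stay in the image and
    determine the derivative.\<close>
  have "?D \<noteq> (\<lambda>v. 0)"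
  proof -
    obtain D' where D': "(?f has_derivative D') (at x0 within ?S)" "D' \<noteq> (\<lambda>v. 0)"
      using bdf p c unfolding boundary_defining_function_def nonzero_differential_at_def x0_def by metis
    have "(?f has_derivative ?D) (at x0 within ?S)"
    proof (rule has_derivative_transform_within[OF has_derivative_at_withinI[OF Fder[OF U(2)]] r(1) x0S])
      fix x assume "x \<in> ?S" "dist x x0 < r"
      with r(2) U(5) show "F x = ?f x" by blast
    qed
    then have "D' = ?D"
    proof (rule frechet_derivative_unique_within[OF D'(1)])
      fix i :: "real^'n" and e :: real
      assume "i \<in> Basis" "0 < e"
      then obtain k where i: "i = axis k 1" by (auto simp: Basis_vec_def)
      let ?d = "min e r / 2"
      have "0 < ?d" "?d < e" "?d < r" using \<open>0 < e\<close> r(1) by auto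
      then have "dist (x0 + ?d *\<^sub>R i) x0 < r" "x0 + ?d *\<^sub>R i \<in> quadrant ?K"
        unfolding i by (intro step step_quadrant; simp)+
      then have "x0 + ?d *\<^sub>R i \<in> ?S" using r(2) by blast
      with \<open>0 < ?d\<close> \<open>?d < e\<close> show "\<exists>d. 0 < \<bar>d\<bar> \<and> \<bar>d\<bar> < e \<and> x0 + d *\<^sub>R i \<in> ?S"
        by (intro exI[of _ ?d]) auto
    qed
    with D'(2) show ?thesis by simp
  qed
  moreover have "?D = (\<lambda>v. 0)" if "\<forall>k. ?D (axis k 1) = 0"
    by (rule linear_eq_stdbasis[OF D.linear_axioms]) (use that in \<open>auto simp: Basis_vec_def linear_zero\<close>)
  ultimately obtain k where k: "?D (axis k 1) \<noteq> 0" by blast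
  define e where "e = (axis k 1 :: real^'n)"
  have line: "((\<lambda>t. F (y + t *\<^sub>R e)) has_real_derivative frechet_derivative F (at (y + t *\<^sub>R e)) e) (at t)"
    if "y + t *\<^sub>R e \<in> U" for y t
  proof -
    interpret L: linear "frechet_derivative F (at (y + t *\<^sub>R e))"
      using Fder[OF that] by (rule has_derivative_linear)
    have "((\<lambda>t. y + t *\<^sub>R e) has_derivative (\<lambda>h. h *\<^sub>R e)) (at t)"
      by (auto intro!: derivative_eq_intros)
    from has_derivative_compose[OF this Fder[OF that]]
    show ?thesis by (simp add: has_field_derivative_def L.scaleR mult.commute[of _ "frechet_derivative F _ _"])
  qed
  have der0: "((\<lambda>t. F (x0 + t *\<^sub>R e)) has_real_derivative ?D e) (at 0)"
    using line[of x0 0] U(2) by simp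
  \<comment> \<open>A step along \<open>+e\<close> never leaves the quadrant, so a negative
    derivative would make \<open>F\<close> negative there, starting from
    \<open>F x0 = 0\<close>.\<close>
  have De: "0 < ?D e"
  proof (rule ccontr)
    assume "\<not> 0 < ?D e"
    then have "?D e < 0" using k by (auto simp: e_def)
    from DERIV_neg_dec_right[OF der0 this] obtain d where
      d: "0 < d" "\<And>h. 0 < h \<Longrightarrow> h < d \<Longrightarrow> F (x0 + h *\<^sub>R e) < 0"
      using F0 by auto
    let ?h = "min d r / 2"
    have h: "0 < ?h" "?h < d" "?h < r" using d(1) r(1) by auto
    then have "0 \<le> F (x0 + ?h *\<^sub>R e)"
      unfolding e_def by (intro Fnonneg step step_quadrant) auto
    with d(2)[OF h(1,2)] show False by simp
  qed
  have wall: "k \<in> ?K" "x0 $ k = 0"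
  proof -
    have "k \<in> ?K \<and> x0 $ k = 0"
    proof (rule ccontr)
      assume n: "\<not> (k \<in> ?K \<and> x0 $ k = 0)"
      \<comment> \<open>\<open>b\<close> is the room for a step along \<open>-e\<close>: the
        distance to wall \<open>k\<close>, or any positive number if coordinate \<open>k\<close> is
        unrestricted. With such room the positive derivative would make \<open>F\<close>
        negative.\<close>
      define b where "b = (if k \<in> ?K then x0 $ k else 1)"
      have b: "0 < b" using n x0Q by (auto simp: b_def quadrant_def order_less_le)
      from DERIV_pos_inc_left[OF der0 De] obtain d where
        d: "0 < d" "\<And>h. 0 < h \<Longrightarrow> h < d \<Longrightarrow> F (x0 + (- h) *\<^sub>R e) < 0"
        using F0 by auto
      let ?h = "min d (min r b) / 2"
      have h: "0 < ?h" "?h < d" "?h < r" "?h \<le> b" using d(1) r(1) b by auto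
      have "0 \<le> F (x0 + (- ?h) *\<^sub>R e)"
        unfolding e_def by (intro Fnonneg step step_quadrant) (use h in \<open>auto simp: b_def split: if_splits\<close>)
      with d(2)[OF h(1,2)] show False by simp
    qed
    then show "k \<in> ?K" "x0 $ k = 0" by auto
  qed
  \<comment> \<open>Half the slope at \<open>x0\<close> persists as a lower bound on a
    neighbourhood, by continuity of the derivative.\<close>
  define m where "m = ?D e / 2"
  have m: "0 < m" using De by (simp add: m_def)
  have "\<forall>\<^sub>F y in nhds x0. y \<in> U \<longrightarrow> frechet_derivative F (at y) e \<in> {m<..}"
    by (rule eventually_nhds_continuous_on[OF U(4)]) (use U(2) De in \<open>auto simp: m_def\<close>)
  then obtain r' where r': "0 < r'" "\<And>y. dist y x0 < r' \<Longrightarrow> y \<in> U \<Longrightarrow> m < frechet_derivative F (at y) e"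
    unfolding eventually_nhds_metric by auto
  have bound: "m * x $ k \<le> \<rho> (chart_inv c x)" if x: "dist x x0 < min r r'" "x \<in> quadrant ?K" for x
  proof -
    have Fx: "F x = \<rho> (chart_inv c x)" using r(2)[of x] U(5)[of x] x by auto
    have xk: "0 \<le> x $ k" using x(2) wall(1) by (auto simp: quadrant_def)
    \<comment> \<open>The foot of \<open>x\<close> on wall \<open>k\<close>, where \<open>F\<close>
      is still nonnegative. Since \<open>x0\<close> has zero \<open>k\<close>-th coordinate, the
      segment from the foot to \<open>x\<close> is nowhere farther from \<open>x0\<close> than
      \<open>x\<close> is.\<close>
    let ?y = "x - x $ k *\<^sub>R e"
    have close: "dist (?y + t *\<^sub>R e) x0 < min r r'" if "0 \<le> t" "t \<le> x $ k" for t
    proof -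
      have "norm (?y + t *\<^sub>R e - x0) \<le> norm (x - x0)"
      proof (rule norm_le_componentwise_cart)
        fix i show "norm ((?y + t *\<^sub>R e - x0) $ i) \<le> norm ((x - x0) $ i)"
          using that wall(2) by (cases "i = k") (auto simp: e_def axis_def)
      qed
      with x(1) show ?thesis by (simp add: dist_norm)
    qed
    have "?y \<in> quadrant ?K" using x(2) by (auto simp: quadrant_def e_def axis_def)
    then have "0 \<le> F ?y" using close[of 0] xk by (intro Fnonneg) auto
    show ?thesis
    proof (cases "x $ k = 0")
      case True
      with x Fnonneg[of x] Fx show ?thesis by simp
    next
      case False
      with xk have "0 < x $ k" by simp
      have "\<exists>z>0. z < x $ k \<and> F (?y + (x $ k) *\<^sub>R e) - F (?y + 0 *\<^sub>R e)
          = (x $ k - 0) * frechet_derivative F (at (?y + z *\<^sub>R e)) e"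
        using \<open>0 < x $ k\<close>
      proof (rule MVT2)
        fix t assume "0 \<le> t" "t \<le> x $ k"
        then show "((\<lambda>t. F (?y + t *\<^sub>R e)) has_real_derivative frechet_derivative F (at (?y + t *\<^sub>R e)) e) (at t)"
          using close[of t] r(2) by (intro line) auto
      qed
      then obtain z where z: "0 < z" "z < x $ k" "F x - F ?y = x $ k * frechet_derivative F (at (?y + z *\<^sub>R e)) e"
        by auto
      have "m < frechet_derivative F (at (?y + z *\<^sub>R e)) e"
        using close[of z] z r(2) by (intro r'(2)) auto
      then have "x $ k * m \<le> F x - F ?y" unfolding z(3) using \<open>0 < x $ k\<close> by (intro mult_left_mono) auto
      with \<open>0 \<le> F ?y\<close> Fx show ?thesis by (simp add: mult.commute)
    qed
  qed
  have "\<forall>\<^sub>F x in nhds x0. x \<in> quadrant ?K \<longrightarrow> m * x $ k \<le> \<rho> (chart_inv c x)"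
    unfolding eventually_nhds_metric
    by (rule exI[of _ "min r r'"]) (use bound r(1) r'(1) in auto)
  with wall(1) m show ?thesis unfolding x0_def by blast
qed

text \<open>Asking that all wall coordinates be at least \<open>h\<close> hides which wall belongs
  to \<open>\<rho>\<close>, so the bounds for different hypersurfaces can be added. If
  \<open>p\<close> is off \<open>H\<close>, then \<open>\<rho>\<close> is bounded below and
  \<open>1 \<le> h powr (- M)\<close>; this is why \<open>M\<close> has to dominate active weights
  only.\<close>

lemma eventually_bdf_powr_le:
  assumes c: "c \<in> \<A>" and p: "p \<in> chart_dom c"
    and bdf: "boundary_defining_function X \<A> H \<rho>"
    and "0 \<le> \<alpha>" "0 \<le> M" and M: "p \<in> H \<Longrightarrow> \<alpha> \<le> M"
  shows "\<exists>C\<ge>0. \<forall>\<^sub>F x in nhds (chart_map c p). x \<in> quadrant (chart_walls c) \<longrightarrow>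
    (\<forall>h. 0 < h \<and> h \<le> 1 \<and> (\<forall>j\<in>chart_walls c. h \<le> x $ j) \<longrightarrow> \<rho> (chart_inv c x) powr (- \<alpha>) \<le> C * h powr (- M))"
proof (cases "p \<in> H")
  case True
  obtain j m where j: "j \<in> chart_walls c" and m: "0 < m"
    and ev: "\<forall>\<^sub>F x in nhds (chart_map c p). x \<in> quadrant (chart_walls c) \<longrightarrow> m * x $ j \<le> \<rho> (chart_inv c x)"
    using eventually_bdf_at_face[OF c p True bdf] by blast
  show ?thesis
  proof (intro exI[of _ "m powr (- \<alpha>)"] conjI)
    show "\<forall>\<^sub>F x in nhds (chart_map c p). x \<in> quadrant (chart_walls c) \<longrightarrow>
      (\<forall>h. 0 < h \<and> h \<le> 1 \<and> (\<forall>j\<in>chart_walls c. h \<le> x $ j) \<longrightarrow> \<rho> (chart_inv c x) powr (- \<alpha>) \<le> m powr (- \<alpha>) * h powr (- M))"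
      using ev
    proof eventually_elim
      case (elim x)
      have "\<rho> (chart_inv c x) powr (- \<alpha>) \<le> m powr (- \<alpha>) * h powr (- M)"
        if "x \<in> quadrant (chart_walls c)" "0 < h" "h \<le> 1" "h \<le> x $ j" for h
      proof (rule powr_le_scaled)
        have "m * h \<le> m * x $ j" using that m by simp
        with elim that show "m * h \<le> \<rho> (chart_inv c x)" by linarith
      qed (use that m M[OF True] \<open>0 \<le> \<alpha>\<close> in auto)
      with j show ?case by blast
    qed
  qed simp
next
  case False
  obtain m where m: "0 < m"
    and ev: "\<forall>\<^sub>F x in nhds (chart_map c p). x \<in> quadrant (chart_walls c) \<longrightarrow> m \<le> \<rho> (chart_inv c x)"
    using eventually_bdf_away_from_face[OF c p False bdf] by blast
  show ?thesis
  proof (intro exI[of _ "m powr (- \<alpha>)"] conjI)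
    show "\<forall>\<^sub>F x in nhds (chart_map c p). x \<in> quadrant (chart_walls c) \<longrightarrow>
      (\<forall>h. 0 < h \<and> h \<le> 1 \<and> (\<forall>j\<in>chart_walls c. h \<le> x $ j) \<longrightarrow> \<rho> (chart_inv c x) powr (- \<alpha>) \<le> m powr (- \<alpha>) * h powr (- M))"
      using ev
    proof eventually_elim
      case (elim x)
      have "\<rho> (chart_inv c x) powr (- \<alpha>) \<le> m powr (- \<alpha>) * h powr (- M)"
        if "x \<in> quadrant (chart_walls c)" "0 < h" "h \<le> 1" for h
      proof -
        have "\<rho> (chart_inv c x) powr (- \<alpha>) \<le> m powr (- \<alpha>) * 1"
          using elim that m \<open>0 \<le> \<alpha>\<close> by (simp add: powr_mono2')
        also have "\<dots> \<le> m powr (- \<alpha>) * h powr (- M)"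
          using powr_mono'[of "- M" 0 h] that \<open>0 \<le> M\<close> by (intro mult_left_mono) auto
        finally show ?thesis .
      qed
      then show ?case by blast
    qed
  qed simp
qed

text \<open>Continuity is available for each fixed pair of vectors. The finitely many pairs of axis
  vectors give a bound uniform in \<open>v\<close> by bilinearity.\<close>

lemma eventually_metric_le:
  assumes g: "riemannian_metric \<A> g" and c: "c \<in> \<A>" and p: "p \<in> chart_dom c"
  shows "\<exists>B\<ge>0. \<forall>\<^sub>F x in nhds (chart_map c p). x \<in> quadrant (chart_walls c) \<longrightarrow>
    (\<forall>v. g c (chart_inv c x) v v \<le> B * (norm v)\<^sup>2)"
proof -
  let ?S = "chart_map c ` chart_dom c"
  let ?e = "\<lambda>i. axis i 1 :: real^'n"
  have x0: "chart_map c p \<in> ?S" using p by blast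
  \<comment> \<open>The summand 1 makes the bound strict at \<open>p\<close>, hence an open
    condition.\<close>
  define b where "b i j = \<bar>g c p (?e i) (?e j)\<bar> + 1" for i j
  have "\<forall>\<^sub>F x in nhds (chart_map c p). x \<in> ?S \<longrightarrow> \<bar>g c (chart_inv c x) (?e i) (?e j)\<bar> \<le> b i j" for i j
  proof -
    have "smooth_on ?S (\<lambda>x. g c (chart_inv c x) (?e i) (?e j))"
      using g c by (auto simp: riemannian_metric_def)
    then have "continuous_on ?S (\<lambda>x. \<bar>g c (chart_inv c x) (?e i) (?e j)\<bar>)"
      by (intro continuous_on_rabs smooth_on_imp_continuous_on)
    from eventually_nhds_continuous_on[OF this x0, of "{..<b i j}"]
    have "\<forall>\<^sub>F x in nhds (chart_map c p). x \<in> ?S \<longrightarrow> \<bar>g c (chart_inv c x) (?e i) (?e j)\<bar> < b i j"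
      using c p by (simp add: b_def)
    then show ?thesis by eventually_elim auto
  qed
  then have "\<forall>\<^sub>F x in nhds (chart_map c p). \<forall>i j. x \<in> ?S \<longrightarrow> \<bar>g c (chart_inv c x) (?e i) (?e j)\<bar> \<le> b i j"
    by (intro eventually_all_finite)
  then have "\<forall>\<^sub>F x in nhds (chart_map c p). x \<in> quadrant (chart_walls c) \<longrightarrow>
    (\<forall>v. g c (chart_inv c x) v v \<le> (\<Sum>i\<in>UNIV. \<Sum>j\<in>UNIV. b i j) * (norm v)\<^sup>2)"
    using eventually_in_chart_image[OF c p]
  proof eventually_elim
    case (elim x)
    have "g c (chart_inv c x) v v \<le> (\<Sum>i\<in>UNIV. \<Sum>j\<in>UNIV. b i j) * (norm v)\<^sup>2"
      if "x \<in> quadrant (chart_walls c)" for v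
    proof -
      let ?g = "g c (chart_inv c x)"
      have xS: "x \<in> ?S" using elim that by blast
      then have bil: "bilinear ?g"
        using g c chart_inv_in_dom[OF xS] by (auto simp: riemannian_metric_def)
      have "?g v v = ?g (\<Sum>i\<in>UNIV. v $ i *\<^sub>R ?e i) (\<Sum>j\<in>UNIV. v $ j *\<^sub>R ?e j)"
        by (simp add: basis_expansion[of v, unfolded scalar_mult_eq_scaleR])
      also have "\<dots> = (\<Sum>i\<in>UNIV. \<Sum>j\<in>UNIV. v $ i * (v $ j * ?g (?e i) (?e j)))"
        using bil by (simp add: bilinear_sum bilinear_lmul bilinear_rmul sum.cartesian_product case_prod_beta)
      also have "\<dots> \<le> (\<Sum>i\<in>UNIV. \<Sum>j\<in>UNIV. b i j * (norm v)\<^sup>2)"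
      proof (intro sum_mono)
        fix i j
        have "v $ i * (v $ j * ?g (?e i) (?e j)) \<le> \<bar>v $ i\<bar> * (\<bar>v $ j\<bar> * \<bar>?g (?e i) (?e j)\<bar>)"
          by (metis abs_ge_self abs_mult)
        also have "\<dots> \<le> norm v * (norm v * b i j)"
          using elim xS by (intro mult_mono component_le_norm_cart) auto
        finally show "v $ i * (v $ j * ?g (?e i) (?e j)) \<le> b i j * (norm v)\<^sup>2"
          by (simp add: power2_eq_square mult_ac)
      qed
      finally show ?thesis by (simp add: sum_distrib_right)
    qed
    then show ?case by blast
  qed
  moreover have "0 \<le> (\<Sum>i\<in>UNIV. \<Sum>j\<in>UNIV. b i j)" by (intro sum_nonneg) (simp add: b_def)
  ultimately show ?thesis by blast
qed

lemma eventually_sum_metric_le: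
  assumes g: "riemannian_metric \<A> g" and c: "c \<in> \<A>" and p: "p \<in> chart_dom c"
    and bdf: "\<forall>i\<in>{1..N}. boundary_defining_function X \<A> (H i) (\<rho> i)"
    and \<alpha>: "\<forall>i\<in>{1..N}. 0 \<le> \<alpha> i" and M: "0 \<le> M" "\<And>i. i \<in> {1..N} \<Longrightarrow> p \<in> H i \<Longrightarrow> \<alpha> i \<le> M"
  shows "\<exists>C\<ge>0. \<forall>\<^sub>F x in nhds (chart_map c p). x \<in> quadrant (chart_walls c) \<longrightarrow>
    (\<forall>h v. 0 < h \<and> h \<le> 1 \<and> (\<forall>j\<in>chart_walls c. h \<le> x $ j) \<longrightarrow>
      sum_metric N \<rho> \<alpha> g c (chart_inv c x) v v \<le> C * h powr (- M) * (norm v)\<^sup>2)"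
proof -
  let ?P = "\<lambda>i C x. x \<in> quadrant (chart_walls c) \<longrightarrow>
    (\<forall>h. 0 < h \<and> h \<le> 1 \<and> (\<forall>j\<in>chart_walls c. h \<le> x $ j) \<longrightarrow> \<rho> i (chart_inv c x) powr (- \<alpha> i) \<le> C * h powr (- M))"
  have "\<forall>i\<in>{1..N}. \<exists>C\<ge>0. \<forall>\<^sub>F x in nhds (chart_map c p). ?P i C x"
    using bdf \<alpha> M by (intro ballI eventually_bdf_powr_le[OF c p]) auto
  from bchoice[OF this] obtain C where
    "\<forall>i\<in>{1..N}. 0 \<le> C i \<and> (\<forall>\<^sub>F x in nhds (chart_map c p). ?P i (C i) x)" ..
  then have C: "0 \<le> C i" "\<forall>\<^sub>F x in nhds (chart_map c p). ?P i (C i) x" if "i \<in> {1..N}" for i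
    using that by simp_all
  obtain B where B: "0 \<le> B" "\<forall>\<^sub>F x in nhds (chart_map c p). x \<in> quadrant (chart_walls c) \<longrightarrow>
    (\<forall>v. g c (chart_inv c x) v v \<le> B * (norm v)\<^sup>2)"
    using eventually_metric_le[OF g c p] by blast
  have "\<forall>\<^sub>F x in nhds (chart_map c p). \<forall>i\<in>{1..N}. ?P i (C i) x"
    by (intro eventually_ball_finite ballI C(2)) auto
  then have "\<forall>\<^sub>F x in nhds (chart_map c p). x \<in> quadrant (chart_walls c) \<longrightarrow>
    (\<forall>h v. 0 < h \<and> h \<le> 1 \<and> (\<forall>j\<in>chart_walls c. h \<le> x $ j) \<longrightarrow>
      sum_metric N \<rho> \<alpha> g c (chart_inv c x) v v \<le> (\<Sum>i=1..N. C i) * B * h powr (- M) * (norm v)\<^sup>2)"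
    using B(2)
  proof eventually_elim
    case (elim x)
    have "sum_metric N \<rho> \<alpha> g c (chart_inv c x) v v \<le> (\<Sum>i=1..N. C i) * B * h powr (- M) * (norm v)\<^sup>2"
      if x: "x \<in> quadrant (chart_walls c)" and h: "0 < h" "h \<le> 1" "\<forall>j\<in>chart_walls c. h \<le> x $ j" for h v
    proof -
      have "(\<Sum>i=1..N. \<rho> i (chart_inv c x) powr (- \<alpha> i)) \<le> (\<Sum>i=1..N. C i * h powr (- M))"
        using elim(1) x h by (intro sum_mono) blast
      moreover have "g c (chart_inv c x) v v \<le> B * (norm v)\<^sup>2" using elim(2) x by blast
      ultimately have "sum_metric N \<rho> \<alpha> g c (chart_inv c x) v v \<le> (\<Sum>i=1..N. C i * h powr (- M)) * (B * (norm v)\<^sup>2)"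
        unfolding sum_metric_def using B(1) C(1)
        by (intro order_trans[OF mult_left_mono mult_right_mono] sum_nonneg) auto
      then show ?thesis by (simp add: sum_distrib_right[symmetric] mult_ac)
    qed
    then show ?case by blast
  qed
  moreover have "0 \<le> (\<Sum>i=1..N. C i) * B" using B(1) C(1) by (intro mult_nonneg_nonneg sum_nonneg) auto
  ultimately show ?thesis by blast
qed

subsection \<open>Distances near a point\<close>

text \<open>The curve is the chart segment from \<open>x\<close> to \<open>y\<close>, lifted off all walls by \<open>s t (1 - t)\<close>; its
  speed is then dominated by a Beta integrand, which is integrable because \<open>M < 2\<close>.\<close>

lemma distance_le_of_metric_le:
  fixes g :: "('a, 'n) metric_tensor"
  assumes c: "c \<in> \<A>" and M: "0 \<le> M" "M < 2" and C: "0 \<le> C"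
    and law: "transforms_as_tensor \<A> g"
    and image: "\<And>x. dist x x0 < r \<Longrightarrow> x \<in> quadrant (chart_walls c) \<Longrightarrow> x \<in> chart_map c ` chart_dom c"
    and bound: "\<And>x h v. \<lbrakk>dist x x0 < r; x \<in> quadrant (chart_walls c); 0 < h; h \<le> 1; \<forall>j\<in>chart_walls c. h \<le> x $ j\<rbrakk>
        \<Longrightarrow> g c (chart_inv c x) v v \<le> C * h powr (- M) * (norm v)\<^sup>2"
    and s: "0 < s" "s \<le> 1" "s * norm (1 :: real^'n) \<le> r / 2"
    and x: "x \<in> pos_quadrant (chart_walls c)" "dist x x0 < r / 2"
    and y: "y \<in> pos_quadrant (chart_walls c)" "dist y x0 < r / 2" and xy: "dist x y \<le> s"
  shows "riemannian_distance X \<A> (mfd_interior X \<A>) g (chart_inv c x) (chart_inv c y)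
    \<le> ennreal (sqrt C * (1 + norm (1 :: real^'n)) * Beta (1 - M/2) (1 - M/2) * s powr (1 - M/2))"
proof -
  let ?K = "chart_walls c" and ?L = "norm (1 :: real^'n)"
  define \<kappa> where "\<kappa> t = x + t *\<^sub>R (y - x) + (s * t * (1 - t)) *\<^sub>R 1" for t
  define \<kappa>' where "\<kappa>' t = (y - x) + (s * (1 - 2 * t)) *\<^sub>R 1" for t
  have der: "(\<kappa> has_vector_derivative \<kappa>' t) (at t)" for t
    unfolding \<kappa>_def \<kappa>'_def
    by (auto intro!: derivative_eq_intros simp: algebra_simps)
  have cont': "continuous_on {0..1} \<kappa>'" unfolding \<kappa>'_def by (intro continuous_intros)
  have lift: "0 \<le> s * t * (1 - t) \<and> s * t * (1 - t) \<le> s" if "t \<in> {0..1}" for t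
    using that s by (auto simp: mult.assoc mult_le_one intro!: mult_left_le)
  have coord: "\<kappa> t $ j = (1 - t) * x $ j + t * y $ j + s * t * (1 - t)" for t j
    by (simp add: \<kappa>_def algebra_simps)
  have segment: "0 < (1 - t) * x $ j + t * y $ j" if "t \<in> {0..1}" "j \<in> ?K" for t j
  proof (cases "t = 0")
    case False
    then have "0 < t * y $ j" "0 \<le> (1 - t) * x $ j"
      using that x(1) y(1) by (auto simp: pos_quadrant_def less_imp_le)
    then show ?thesis by linarith
  qed (use that x(1) in \<open>auto simp: pos_quadrant_def\<close>)
  have pos: "\<kappa> t \<in> pos_quadrant ?K" if t: "t \<in> {0..1}" for t
    using segment[OF t] lift[OF t] by (auto simp: pos_quadrant_def coord intro: add_pos_nonneg)
  \<comment> \<open>One half of \<open>r\<close> accommodates the segment, by convexity of the ball;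
    the other half accommodates the lift, along the all-ones vector of norm
    \<open>?L\<close>.\<close>
  have near: "dist (\<kappa> t) x0 < r" if t: "t \<in> {0..1}" for t
  proof -
    have "dist (x + t *\<^sub>R (y - x)) x0 < r / 2"
      using convexD_alt[OF convex_ball, of x x0 "r/2" y t] t x(2) y(2)
      by (simp add: dist_commute algebra_simps)
    moreover have "norm ((s * t * (1 - t)) *\<^sub>R (1 :: real^'n)) \<le> s * ?L"
      using lift[OF t] by (auto intro!: mult_right_mono)
    moreover have "dist (\<kappa> t) x0 \<le> dist (x + t *\<^sub>R (y - x)) x0 + norm ((s * t * (1 - t)) *\<^sub>R (1 :: real^'n))"
      unfolding \<kappa>_def dist_norm by (metis add.commute add_diff_eq norm_triangle_ineq)
    ultimately show ?thesis using s(3) by linarith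
  qed
  have in_chart: "\<kappa> t \<in> chart_map c ` chart_dom c \<inter> pos_quadrant ?K" if "t \<in> {0..1}" for t
    using near[OF that] pos[OF that] image pos_quadrant_subset by blast
  have curve_speed: "curve_speed \<A> g (chart_inv c \<circ> \<kappa>) t = sqrt (g c (chart_inv c (\<kappa> t)) (\<kappa>' t) (\<kappa>' t))"
    if "t \<in> {0..1}" for t
    by (rule curve_speed_chart_curve[where g = g and \<kappa> = \<kappa> and \<kappa>' = \<kappa>', OF c in_chart der cont' law that])
  have speed_norm: "norm (\<kappa>' t) \<le> s * (1 + ?L)" if t: "t \<in> {0..1}" for t
  proof -
    have "norm (\<kappa>' t) \<le> norm (y - x) + \<bar>s * (1 - 2 * t)\<bar> * ?L"
      unfolding \<kappa>'_def by (rule order_trans[OF norm_triangle_ineq]) simp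
    also have "\<dots> \<le> s + s * ?L"
    proof (intro add_mono mult_right_mono)
      show "norm (y - x) \<le> s" using xy by (simp add: dist_norm norm_minus_commute)
      show "\<bar>s * (1 - 2 * t)\<bar> \<le> s" using t s by (auto simp: abs_mult intro!: mult_left_le)
    qed simp
    finally show ?thesis by (simp add: algebra_simps)
  qed
  \<comment> \<open>The power of \<open>s\<close> combines a factor \<open>s\<close> from the
    Euclidean speed with \<open>s powr (- (M/2))\<close> from the square root of the metric bound at
    height \<open>s * t * (1 - t)\<close>.\<close>
  define A where "A = sqrt C * (1 + ?L) * s powr (1 - M/2)"
  have A: "0 \<le> A" using C by (simp add: A_def)
  \<comment> \<open>Both exponents equal \<open>- M/2\<close>; they are written as parameter minus
    one to match the Beta density.\<close>
  let ?w = "\<lambda>t. t powr ((1 - M/2) - 1) * (1 - t) powr ((1 - M/2) - 1)"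
  have speed: "curve_speed \<A> g (chart_inv c \<circ> \<kappa>) t \<le> A * ?w t" if t: "0 < t" "t < 1" for t
  proof -
    let ?h = "s * t * (1 - t)"
    have t': "t \<in> {0..1}" using t by simp
    have "g c (chart_inv c (\<kappa> t)) (\<kappa>' t) (\<kappa>' t) \<le> C * ?h powr (- M) * (norm (\<kappa>' t))\<^sup>2"
    proof (rule bound[OF near[OF t']])
      show "\<kappa> t \<in> quadrant ?K" using pos[OF t'] pos_quadrant_subset by blast
      show "?h \<le> 1" using lift[OF t'] s(2) by linarith
      show "\<forall>j\<in>?K. ?h \<le> \<kappa> t $ j" using segment[OF t'] by (simp add: coord less_imp_le)
    qed (use t s in simp)
    also have "\<dots> \<le> C * ?h powr (- M) * (s * (1 + ?L))\<^sup>2"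
      using C speed_norm[OF t'] by (intro mult_left_mono power_mono) auto
    also have "\<dots> = C * (?h powr (- (M/2)))\<^sup>2 * (s * (1 + ?L))\<^sup>2"
      by (simp add: power2_eq_square[of "_ powr _"] flip: powr_add)
    finally have "sqrt (g c (chart_inv c (\<kappa> t)) (\<kappa>' t) (\<kappa>' t)) \<le> sqrt (C * (?h powr (- (M/2)))\<^sup>2 * (s * (1 + ?L))\<^sup>2)"
      by simp
    also have "\<dots> = sqrt C * ?h powr (- (M/2)) * (s * (1 + ?L))"
      using s by (simp add: real_sqrt_mult)
    also have "\<dots> = A * ?w t"
    proof -
      have "s * s powr (- (M/2)) = s powr (1 - M/2)"
        using s powr_add[of s 1 "- (M/2)"] by simp
      moreover have "?h powr (- (M/2)) = s powr (- (M/2)) * ?w t"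
        using s t by (simp add: powr_mult)
      ultimately show ?thesis by (simp add: A_def mult_ac)
    qed
    finally show ?thesis unfolding curve_speed[OF t'] .
  qed
  have "riemannian_distance X \<A> (mfd_interior X \<A>) g (chart_inv c x) (chart_inv c y)
      \<le> curve_length \<A> g 0 1 (chart_inv c \<circ> \<kappa>)"
    by (rule riemannian_distance_le[OF piecewise_C1_chart_curve[where \<kappa> = \<kappa> and \<kappa>' = \<kappa>', OF c in_chart der cont']]) (simp_all add: \<kappa>_def)
  also have "\<dots> \<le> (\<integral>\<^sup>+t. ennreal (A * ?w t) * indicator {0..1} t \<partial>lborel)"
    unfolding curve_length_def
  proof (rule nn_integral_mono_AE)
    show "AE t in lborel. ennreal (curve_speed \<A> g (chart_inv c \<circ> \<kappa>) t) * indicator {0..1} t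
        \<le> ennreal (A * ?w t) * indicator {0..1} t"
      using AE_lborel_singleton[of 0] AE_lborel_singleton[of 1]
    proof eventually_elim
      case (elim t)
      then show ?case using speed[of t] by (cases "t \<in> {0..1}") (auto intro!: ennreal_leI)
    qed
  qed
  also have "\<dots> = ennreal (A * Beta (1 - M/2) (1 - M/2))"
  proof (rule nn_integral_has_integral_lebesgue')
    show "((\<lambda>t. A * ?w t) has_integral A * Beta (1 - M/2) (1 - M/2)) {0..1}"
      using M by (intro has_integral_mult_right has_integral_Beta_real) auto
  qed (use A in auto)
  finally show ?thesis by (simp add: A_def mult_ac)
qed

text \<open>The length bound tends to zero with the scale \<open>s\<close> because its exponent
  \<open>1 - M/2\<close> is positive. The scale is fixed first and the neighbourhood is then cut to
  fit it, so the estimate holds for all pairs at once.\<close>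

lemma distance_small_near_point:
  assumes p: "p \<in> topspace X" and g: "riemannian_metric \<A> g"
    and bdf: "\<forall>i\<in>{1..N}. boundary_defining_function X \<A> (H i) (\<rho> i)"
    and \<alpha>: "\<forall>i\<in>{1..N}. 0 \<le> \<alpha> i" and M: "0 \<le> M" "M < 2" "\<And>i. i \<in> {1..N} \<Longrightarrow> p \<in> H i \<Longrightarrow> \<alpha> i \<le> M"
    and "0 < \<epsilon>"
  shows "\<exists>V. openin X V \<and> p \<in> V \<and> (\<forall>a\<in>V \<inter> mfd_interior X \<A>. \<forall>b\<in>V \<inter> mfd_interior X \<A>.
    riemannian_distance X \<A> (mfd_interior X \<A>) (sum_metric N \<rho> \<alpha> g) a b < \<epsilon>)"
proof -
  obtain c where c: "c \<in> \<A>" and pc: "p \<in> chart_dom c"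
    using chart_at[OF p] by blast
  let ?K = "chart_walls c" and ?L = "norm (1 :: real^'n)"
  define x0 where "x0 = chart_map c p"
  obtain C where C: "0 \<le> C" and ev: "\<forall>\<^sub>F x in nhds x0. x \<in> quadrant ?K \<longrightarrow>
    (\<forall>h v. 0 < h \<and> h \<le> 1 \<and> (\<forall>j\<in>?K. h \<le> x $ j) \<longrightarrow>
      sum_metric N \<rho> \<alpha> g c (chart_inv c x) v v \<le> C * h powr (- M) * (norm v)\<^sup>2)"
    using eventually_sum_metric_le[OF g c pc bdf \<alpha> M(1,3)] unfolding x0_def by blast
  obtain r where r: "0 < r" and bound: "\<And>x h v. \<lbrakk>dist x x0 < r; x \<in> quadrant ?K; 0 < h; h \<le> 1; \<forall>j\<in>?K. h \<le> x $ j\<rbrakk>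
      \<Longrightarrow> sum_metric N \<rho> \<alpha> g c (chart_inv c x) v v \<le> C * h powr (- M) * (norm v)\<^sup>2"
    and image: "\<And>x. dist x x0 < r \<Longrightarrow> x \<in> quadrant ?K \<Longrightarrow> x \<in> chart_map c ` chart_dom c"
    using eventually_conj[OF ev eventually_in_chart_image[OF c pc, folded x0_def]]
    unfolding eventually_nhds_metric by metis
  define B where "B s = sqrt C * (1 + ?L) * Beta (1 - M/2) (1 - M/2) * s powr (1 - M/2)" for s
  have "(B \<longlongrightarrow> sqrt C * (1 + ?L) * Beta (1 - M/2) (1 - M/2) * 0) (at_right 0)"
    unfolding B_def using M(2)
    by (intro tendsto_mult_left tendsto_zero_powrI[of _ _ _ "1 - M/2"] tendsto_const)
      (auto intro!: eventually_at_right_less tendsto_ident_at simp: eventually_at_filter)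
  then have "((\<lambda>s. ennreal (B s)) \<longlongrightarrow> 0) (at_right 0)"
    using tendsto_ennrealI by fastforce
  then have B_small: "\<forall>\<^sub>F s in at_right 0. ennreal (B s) < \<epsilon>"
    using \<open>0 < \<epsilon>\<close> by (rule order_tendstoD)
  \<comment> \<open>The second bound on \<open>s\<close> keeps the lift within \<open>r / 2\<close>;
    the summand 1 makes the denominator plainly positive.\<close>
  moreover have "\<forall>\<^sub>F s in at_right 0. s \<in> {0<..<min 1 (r / (2 * (1 + ?L)))}"
    using r by (intro eventually_at_rightI[of 0 "min 1 (r / (2 * (1 + ?L)))"]) (auto simp: add_pos_nonneg)
  ultimately have "\<forall>\<^sub>F s in at_right 0. ennreal (B s) < \<epsilon> \<and> s \<in> {0<..<min 1 (r / (2 * (1 + ?L)))}"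
    by (rule eventually_conj)
  then obtain s where "ennreal (B s) < \<epsilon>" and s: "0 < s" "s < 1" "s < r / (2 * (1 + ?L))"
    using eventually_happens'[OF trivial_limit_at_right_real] by auto
  have sL: "s * ?L \<le> r / 2"
  proof -
    have "s * (1 + ?L) < r / 2" using s(3) by (simp add: field_simps add_pos_nonneg)
    with s(1) show ?thesis by (simp add: algebra_simps)
  qed
  \<comment> \<open>Radius \<open>s / 2\<close> puts any two points of \<open>V\<close> at
    coordinate distance at most \<open>s\<close>.\<close>
  define V where "V = {q \<in> chart_dom c. chart_map c q \<in> ball x0 (min (r / 2) (s / 2))}"
  have "openin (subtopology X (chart_dom c)) V"
    using openin_continuous_map_preimage[OF continuous_map_chart_map[OF c], of "ball x0 (min (r / 2) (s / 2))"]
    by (simp add: V_def topspace_chart_dom[OF c, simplified])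
  then have "openin X V" by (rule openin_trans_full[OF _ openin_chart_dom[OF c]])
  moreover have "p \<in> V" using pc r s by (simp add: V_def x0_def)
  moreover have "riemannian_distance X \<A> (mfd_interior X \<A>) (sum_metric N \<rho> \<alpha> g) a b < \<epsilon>"
    if a: "a \<in> V \<inter> mfd_interior X \<A>" and b: "b \<in> V \<inter> mfd_interior X \<A>" for a b
  proof -
    let ?x = "chart_map c a" and ?y = "chart_map c b"
    have near: "dist ?x x0 < r / 2" "dist ?y x0 < r / 2" "dist ?x x0 < s / 2" "dist ?y x0 < s / 2"
      using a b by (auto simp: V_def dist_commute)
    have "dist ?x ?y \<le> s" using near(3,4) dist_triangle2[of ?x ?y x0] by linarith
    have "riemannian_distance X \<A> (mfd_interior X \<A>) (sum_metric N \<rho> \<alpha> g)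
        (chart_inv c ?x) (chart_inv c ?y) \<le> ennreal (B s)"
      unfolding B_def
    proof (rule distance_le_of_metric_le[where c = c and C = C and M = M and s = s])
      show "?x \<in> pos_quadrant ?K" "?y \<in> pos_quadrant ?K"
        using a b chart_map_interior_pos[OF c] by (auto simp: V_def)
    qed (fact c M(1) M(2) C transforms_as_tensor_sum_metric[OF g] image s(1) less_imp_le[OF s(2)] sL near
        \<open>dist ?x ?y \<le> s\<close> | rule bound; assumption)+
    also have "\<dots> < \<epsilon>" by fact
    finally show ?thesis using a b c by (simp add: V_def)
  qed
  ultimately show ?thesis by blast
qed

text \<open>The common point of the completion has to be exhibited as the class of some sequence.
  Moving \<open>p\<close> along the all-ones vector makes every wall coordinate positive.\<close>

lemma interior_sequence_to_point:
  assumes p: "p \<in> topspace X"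
  obtains q where "range q \<subseteq> mfd_interior X \<A>" "limitin X q p sequentially"
proof -
  obtain c where c: "c \<in> \<A>" and pc: "p \<in> chart_dom c"
    using chart_at[OF p] by blast
  let ?K = "chart_walls c" and ?S = "chart_map c ` chart_dom c"
  define x where "x n = chart_map c p + inverse (real (Suc n)) *\<^sub>R 1" for n
  have x0: "chart_map c p \<in> ?S" using pc by blast
  have pos: "x n \<in> pos_quadrant ?K" for n
  proof -
    have "chart_map c p \<in> quadrant ?K" using x0 chart_image_subset_quadrant[OF c] by blast
    then show ?thesis by (auto simp: x_def quadrant_def pos_quadrant_def intro!: add_nonneg_pos)
  qed
  have "(\<lambda>n. x n) \<longlonglongrightarrow> chart_map c p + 0 *\<^sub>R 1"
    unfolding x_def by (intro tendsto_intros LIMSEQ_inverse_real_of_nat)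
  then have lim: "x \<longlonglongrightarrow> chart_map c p" by simp
  have "\<forall>\<^sub>F n in sequentially. x n \<in> quadrant ?K \<longrightarrow> x n \<in> ?S"
    using eventually_compose_filterlim[OF eventually_in_chart_image[OF c pc] lim] .
  \<comment> \<open>Early terms may lie outside the chart image, so the sequence is started at index
    \<open>k\<close>.\<close>
  then obtain k where k: "\<And>n. k \<le> n \<Longrightarrow> x n \<in> ?S"
    using pos pos_quadrant_subset unfolding eventually_sequentially by blast
  let ?q = "\<lambda>n. chart_inv c (x (n + k))"
  have "limitin (top_of_set ?S) (\<lambda>n. x (n + k)) (chart_map c p) sequentially"
    using LIMSEQ_ignore_initial_segment[OF lim, of k] x0 k by (simp add: limitin_subtopology)
  from continuous_map_limit[OF continuous_map_chart_inv[OF c] this]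
  have "limitin X ?q p sequentially" using c pc by (simp add: o_def)
  moreover have "range ?q \<subseteq> mfd_interior X \<A>" using chart_inv_pos_interior[OF c] k pos by auto
  ultimately show thesis by (rule that[rotated])
qed

end

section \<open>Classes of Cauchy sequences and the completion\<close>

lemma cauchy_equiv_Image_cong:
  assumes tri: "\<And>x y z. d x z \<le> d x y + d y z"
    and q: "q \<in> cauchy_seqs M d" "q' \<in> cauchy_seqs M d"
    and lim: "(\<lambda>n. d (q n) (q' n)) \<longlonglongrightarrow> 0" "(\<lambda>n. d (q' n) (q n)) \<longlonglongrightarrow> 0"
  shows "cauchy_equiv M d `` {q} = cauchy_equiv M d `` {q'}"
proof -
  \<comment> \<open>Transitivity, used once for each inclusion of classes. The two limits in the
    hypotheses stand in for symmetry of \<open>d\<close>.\<close>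
  have sub: "(\<lambda>n. d (r n) (u n)) \<longlonglongrightarrow> 0"
    if "(\<lambda>n. d (r n) (r' n)) \<longlonglongrightarrow> 0" "(\<lambda>n. d (r' n) (u n)) \<longlonglongrightarrow> 0" for r r' u
  proof (rule tendsto_sandwich[of "\<lambda>_. 0"])
    show "(\<lambda>n. d (r n) (r' n) + d (r' n) (u n)) \<longlonglongrightarrow> 0"
      using tendsto_add[OF that] by simp
  qed (simp_all add: tri)
  show ?thesis using q sub[OF lim(1)] sub[OF lim(2)] by (auto simp: cauchy_equiv_def)
qed

theorem theorem4p5:
  fixes X :: "'a topology"
    and \<A> :: "('a, 'n::finite) corner_chart set"
    and N :: nat
    and H :: "nat \<Rightarrow> 'a set"
    and \<rho> :: "nat \<Rightarrow> 'a \<Rightarrow> real"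
    and \<alpha> :: "nat \<Rightarrow> real"
    and g0 :: "('a, 'n) metric_tensor"
    and I :: "nat set"
    and p :: 'a
  defines "X0 \<equiv> mfd_interior X \<A>"
    and "d \<equiv> riemannian_distance X \<A> (mfd_interior X \<A>) (sum_metric N \<rho> \<alpha> g0)"
  assumes "manifold_with_corners X \<A>"
    and "compact_space X"
    and "bij_betw H {1..N} (boundary_hypersurfaces X \<A>)"
    and "\<forall>i\<in>{1..N}. embedded_hypersurface X \<A> (H i)"
    and "\<forall>i\<in>{1..N}. boundary_defining_function X \<A> (H i) (\<rho> i)"
    and "riemannian_metric \<A> g0"
    and "\<forall>i\<in>{1..N}. 0 \<le> \<alpha> i"
    and "I \<noteq> {}" and "I \<subseteq> {1..N}"
    and "p \<in> open_face X N H I"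
    and "Max (\<alpha> ` I) < 2"
  shows "(\<forall>q q'. range q \<subseteq> X0 \<and> range q' \<subseteq> X0 \<and>
              limitin X q p sequentially \<and> limitin X q' p sequentially \<longrightarrow>
              (\<lambda>n. d (q n) (q' n)) \<longlonglongrightarrow> 0) \<and>
         (\<exists>\<xi>\<in>metric_completion X0 d.
              \<forall>q. range q \<subseteq> X0 \<and> limitin X q p sequentially \<longrightarrow> determines_point X0 d q \<xi>)"
proof -
  interpret corner_manifold X \<A> by standard fact
  have p: "p \<in> topspace X" and I: "I = {i\<in>{1..N}. p \<in> H i}"
    using \<open>p \<in> open_face X N H I\<close> by (auto simp: open_face_def active_index_set_def)
  have fin: "finite I" using \<open>I \<subseteq> {1..N}\<close> finite_subset by blast
  have max: "\<alpha> i \<le> Max (\<alpha> ` I)" if "i \<in> I" for i using fin that by simp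
  \<comment> \<open>Nonnegativity of the exponent is what makes \<open>h powr (- M)\<close> at least
    1 for \<open>h \<le> 1\<close>, as the inactive hypersurfaces require.\<close>
  have M0: "0 \<le> Max (\<alpha> ` I)"
  proof -
    obtain i where "i \<in> I" using \<open>I \<noteq> {}\<close> by blast
    moreover from this have "0 \<le> \<alpha> i"
      using \<open>I \<subseteq> {1..N}\<close> \<open>\<forall>i\<in>{1..N}. 0 \<le> \<alpha> i\<close> by blast
    ultimately show ?thesis using max by fastforce
  qed
  have small: "\<exists>V. openin X V \<and> p \<in> V \<and> (\<forall>a\<in>V \<inter> X0. \<forall>b\<in>V \<inter> X0. d a b < \<epsilon>)" if "0 < \<epsilon>" for \<epsilon>
    unfolding X0_def d_def
    by (rule distance_small_near_point[where M = "Max (\<alpha> ` I)", OF p]) (use assms that M0 max I in auto)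
  have pair: "(\<lambda>n. d (q n) (q' n)) \<longlonglongrightarrow> 0"
    if q: "range q \<subseteq> X0" "limitin X q p sequentially" and q': "range q' \<subseteq> X0" "limitin X q' p sequentially"
    for q q'
  proof (rule order_tendstoI)
    fix \<epsilon> :: ennreal assume "0 < \<epsilon>"
    then obtain V where V: "openin X V" "p \<in> V" "\<forall>a\<in>V \<inter> X0. \<forall>b\<in>V \<inter> X0. d a b < \<epsilon>"
      using small by blast
    have "\<forall>\<^sub>F n in sequentially. q n \<in> V" "\<forall>\<^sub>F n in sequentially. q' n \<in> V"
      using q(2) q'(2) V(1,2) by (auto simp: limitin_def)
    then show "\<forall>\<^sub>F n in sequentially. d (q n) (q' n) < \<epsilon>"
    proof eventually_elim
      case (elim n)
      have "q n \<in> X0" "q' n \<in> X0" using q(1) q'(1) by auto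
      with elim V(3) show ?case by blast
    qed
  qed simp
  have cauchy: "q \<in> cauchy_seqs X0 d" if q: "range q \<subseteq> X0" "limitin X q p sequentially" for q
  proof -
    have "\<exists>k. \<forall>m\<ge>k. \<forall>n\<ge>k. d (q m) (q n) < \<epsilon>" if "0 < \<epsilon>" for \<epsilon>
    proof -
      obtain V where V: "openin X V" "p \<in> V" "\<forall>a\<in>V \<inter> X0. \<forall>b\<in>V \<inter> X0. d a b < \<epsilon>"
        using small[OF \<open>0 < \<epsilon>\<close>] by blast
      have "\<forall>\<^sub>F n in sequentially. q n \<in> V" using q(2) V(1,2) by (auto simp: limitin_def)
      then obtain k where "\<And>n. k \<le> n \<Longrightarrow> q n \<in> V" unfolding eventually_sequentially by blast
      moreover have "q n \<in> X0" for n using q(1) by auto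
      ultimately show ?thesis using V(3) by blast
    qed
    with q(1) show ?thesis by (simp add: cauchy_seqs_def)
  qed
  obtain q0 where q0: "range q0 \<subseteq> X0" "limitin X q0 p sequentially"
    using interior_sequence_to_point[OF p] unfolding X0_def by blast
  have tri: "d x z \<le> d x y + d y z" for x y z
    unfolding d_def by (rule riemannian_distance_triangle)
  show ?thesis
  \<comment> \<open>One reference sequence \<open>q0\<close> fixes the point; every other sequence
    converging to \<open>p\<close> has the same class.\<close>
  proof (intro conjI bexI[of _ "cauchy_equiv X0 d `` {q0}"] allI impI)
    fix q assume q: "range q \<subseteq> X0 \<and> limitin X q p sequentially"
    then have "cauchy_equiv X0 d `` {q0} = cauchy_equiv X0 d `` {q}"
      using q0 by (intro cauchy_equiv_Image_cong tri cauchy pair) auto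
    with q show "determines_point X0 d q (cauchy_equiv X0 d `` {q0})"
      by (simp add: determines_point_def cauchy)
  next
    show "cauchy_equiv X0 d `` {q0} \<in> metric_completion X0 d"
      unfolding metric_completion_def using cauchy[OF q0] by (rule quotientI)
  qed (use pair in blast)
qed

end
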